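(* Let $\omega$ be a quadratic integrable 1-form on $\mathbb R^n$. Then $\omega$ is the pull-back of a 3-dimensional integrable 1-form (an integrable 1-form in three variables). More precisely: (i) if $d\omega$ is of type 2, then $\omega$ is a quadratic integrable 1-form depending only on three (well chosen) coordinates, i.e. in suitable coordinates $x_1,\dots,x_n$ one has $\omega=\sum_{i=1}^3 a_i(x_1,x_2,x_3)\,dx_i$; (ii) if $d\omega$ is of type 1, then, in a suitable system of coordinates on $\mathbb R^n$, among which are coordinates named $x,y_1,\dots,y_r$ and (when $\epsilon=1$ below) $z$, $$\omega=\phi^*\big((\gamma X^2+\theta Y)\,dX+\beta X\,dY\big),\qquad \phi=\Big(x,\ \sum_{i=1}^r \pm\tfrac{y_i^2}{2}+\epsilon\, xz\Big):\mathbb R^n\to\mathbb R^2,$$ where $(X,Y)$ are the coordinates of $\mathbb R^2$ and $\epsilon,\beta,\theta,\gamma$ are constants with $\epsilon=0$ or $\epsilon=1$. In this last case $\omega$ is, in fact, the pull-back of a 2-dimensional 1-form.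
   Context: A 1-form $\omega$ is integrable if $\omega\wedge d\omega=0$. A 1-form on $\mathbb R^n$ is quadratic if its coefficients in linear coordinates are homogeneous polynomials of degree 2; then $d\omega$ has linear coefficients. Types of $d\omega$. Given a constant volume form $\Omega$, let $D$ be the $(n-2)$-vector field with linear coefficients defined by $i_D\Omega=d\omega$. The 2-form $d\omega$ is of type 2 if, in a suitable coordinate system $x_1,\dots,x_n$, $D=\frac{\partial}{\partial x_4}\wedge\dots\wedge\frac{\partial}{\partial x_n}\wedge X$, where $X$ is a vector field depending on the coordinates $x_1,x_2,x_3$ only (a vector field in these three variables). The 2-form $d\omega$ is of type 1 if $d\omega=dx\wedge dq$, where $q$ is a quadratic form which is either $q=\sum_{i=1}^{r}\pm y_i^2/2+xz$ in a system of coordinates $x,y_1,\dots,y_r,z,t_1,\dots,t_s$ with $r+s=n-2$, or $q=\sum_{i=1}^{r}\pm y_i^2/2$ in a system of coordinates $x,y_1,\dots,y_r,t_1,\dots,t_s$ with $r+s=n-1$; here $r\ge 0$ (the values $r=0$ and $r=1$ are allowed), and the signs $\pm$ are fixed signs.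
   Formalization: In (i) the case dω = 0 with n > 3 is excluded, and the formula in (ii) is claimed only for type 1 normal forms with r + ε ≥ 2; the claims fail in the excluded cases (e.g. ω = d(Σx_i³), or ω = 2xy dx + (xy+x²) dy). The 2-dimensional pull-back is kept for all type 1. *)

theory Defs
  imports "HOL-Analysis.Analysis"
begin

text \<open>
  A 1-form is a function \<open>\<omega> p v\<close> of a point and a tangent vector, linear in \<open>v\<close>; a 2-form
  is a function \<open>\<alpha> p u v\<close>. The coefficient of \<open>dx\<^sub>b\<close> is \<open>\<lambda>p. \<omega> p b\<close>. The definitions are
  given on a Euclidean space, so that they apply to \<open>\<real>\<^sup>n\<close>, \<open>\<real>\<^sup>3\<close> and \<open>\<real>\<^sup>2\<close> alike.
\<close>

type_synonym 'a form1 = "'a \<Rightarrow> 'a \<Rightarrow> real"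
type_synonym 'a form2 = "'a \<Rightarrow> 'a \<Rightarrow> 'a \<Rightarrow> real"

primrec Ck :: "nat \<Rightarrow> ('a::euclidean_space \<Rightarrow> 'b::euclidean_space) \<Rightarrow> bool" where
  "Ck 0 f \<longleftrightarrow> continuous_on UNIV f"
| "Ck (Suc k) f \<longleftrightarrow> (\<forall>p. f differentiable (at p)) \<and>
     (\<forall>v. Ck k (\<lambda>p. frechet_derivative f (at p) v))"

definition smooth :: "('a::euclidean_space \<Rightarrow> 'b::euclidean_space) \<Rightarrow> bool" where
  "smooth f \<longleftrightarrow> (\<forall>k. Ck k f)"

definition smooth_form1 :: "'a::euclidean_space form1 \<Rightarrow> bool" where
  "smooth_form1 \<omega> \<longleftrightarrow> (\<forall>p. linear (\<omega> p)) \<and> (\<forall>v. smooth (\<lambda>p. \<omega> p v))"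

definition d0 :: "('a::euclidean_space \<Rightarrow> real) \<Rightarrow> 'a form1" where
  "d0 f p = frechet_derivative f (at p)"

definition d1 :: "'a::euclidean_space form1 \<Rightarrow> 'a form2" where
  "d1 \<omega> p u v = frechet_derivative (\<lambda>p. \<omega> p v) (at p) u
              - frechet_derivative (\<lambda>p. \<omega> p u) (at p) v"

definition wedge11 :: "'a form1 \<Rightarrow> 'a form1 \<Rightarrow> 'a form2" where
  "wedge11 \<omega> \<eta> p u v = \<omega> p u * \<eta> p v - \<omega> p v * \<eta> p u"

definition wedge12 :: "'a form1 \<Rightarrow> 'a form2 \<Rightarrow> 'a \<Rightarrow> 'a \<Rightarrow> 'a \<Rightarrow> 'a \<Rightarrow> real" where
  "wedge12 \<omega> \<alpha> p u v w = \<omega> p u * \<alpha> p v w + \<omega> p v * \<alpha> p w u + \<omega> p w * \<alpha> p u v"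

definition integrable_form1 :: "'a::euclidean_space form1 \<Rightarrow> bool" where
  "integrable_form1 \<omega> \<longleftrightarrow> (\<forall>p u v w. wedge12 \<omega> (d1 \<omega>) p u v w = 0)"

definition pullback ::
    "('a::euclidean_space \<Rightarrow> 'b::euclidean_space) \<Rightarrow> 'b form1 \<Rightarrow> 'a form1" where
  "pullback F \<eta> p v = \<eta> (F p) (frechet_derivative F (at p) v)"

definition homogeneous_quadratic :: "('a::euclidean_space \<Rightarrow> real) \<Rightarrow> bool" where
  "homogeneous_quadratic f \<longleftrightarrow>
     (\<exists>c. \<forall>p. f p = (\<Sum>b\<in>Basis. \<Sum>b'\<in>Basis. c b b' * (p \<bullet> b) * (p \<bullet> b')))"

definition quadratic_form1 :: "'a::euclidean_space form1 \<Rightarrow> bool" where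
  "quadratic_form1 \<omega> \<longleftrightarrow>
     (\<forall>p. linear (\<omega> p)) \<and> (\<forall>b\<in>Basis. homogeneous_quadratic (\<lambda>p. \<omega> p b))"

text \<open>
  A linear coordinate system consists of \<open>n = DIM('a)\<close> linear functions \<open>x 0, \<dots>, x (n - 1)\<close>
  together with the constant vector fields \<open>e i = \<partial>/\<partial>x\<^sub>i\<close>, the dual basis. Indices start at \<open>0\<close>,
  and only the values at \<open>i < n\<close> are constrained.
\<close>

definition linear_coordinates ::
    "(nat \<Rightarrow> 'a::euclidean_space) \<Rightarrow> (nat \<Rightarrow> 'a \<Rightarrow> real) \<Rightarrow> bool" where
  "linear_coordinates e x \<longleftrightarrow>
     (\<forall>i<DIM('a). linear (x i)) \<and>
     (\<forall>i<DIM('a). \<forall>j<DIM('a). x i (e j) = (if i = j then 1 else 0))"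

text \<open>
  Constant volume form: a nonzero alternating \<open>n\<close>-linear function of \<open>v 0, \<dots>, v (n - 1)\<close>.
\<close>

definition volume_form :: "((nat \<Rightarrow> 'a::euclidean_space) \<Rightarrow> real) \<Rightarrow> bool" where
  "volume_form \<Omega> \<longleftrightarrow>
     (\<forall>v i. i < DIM('a) \<longrightarrow> linear (\<lambda>u. \<Omega> (v(i := u)))) \<and>
     (\<forall>v i j. i < j \<and> j < DIM('a) \<and> v i = v j \<longrightarrow> \<Omega> v = 0) \<and>
     (\<forall>v w. (\<forall>i<DIM('a). v i = w i) \<longrightarrow> \<Omega> v = \<Omega> w) \<and>
     (\<exists>v. \<Omega> v \<noteq> 0)"

text \<open>
  Multivectors are represented by their action on alternating multilinear functions:
  \<open>v 0 \<and> \<dots> \<and> v (k - 1)\<close> sends \<open>\<alpha>\<close> to \<open>\<alpha> (v 0, \<dots>, v (k - 1))\<close>. The contraction of an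
  \<open>n\<close>-form by an \<open>(n - 2)\<close>-vector \<open>D\<close> fills the first \<open>n - 2\<close> slots with \<open>D\<close>.
\<close>

type_synonym 'a multivector = "((nat \<Rightarrow> 'a) \<Rightarrow> real) \<Rightarrow> real"

definition wedge_vectors :: "(nat \<Rightarrow> 'a) \<Rightarrow> 'a multivector" where
  "wedge_vectors v = (\<lambda>\<alpha>. \<alpha> v)"

definition contraction ::
    "'a::euclidean_space multivector \<Rightarrow> ((nat \<Rightarrow> 'a) \<Rightarrow> real) \<Rightarrow> 'a \<Rightarrow> 'a \<Rightarrow> real" where
  "contraction D \<Omega> u w =
     D (\<lambda>v. \<Omega> (\<lambda>i. if i < DIM('a) - 2 then v i else if i = DIM('a) - 2 then u else w))"

text \<open>
  With indices from \<open>0\<close>, \<open>D = e 3 \<and> \<dots> \<and> e (n - 1) \<and> X\<close> where \<open>X\<close> is a combination of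
  \<open>e 0, e 1, e 2\<close> with coefficients in \<open>x 0, x 1, x 2\<close>. When \<open>\<alpha>\<close> has linear coefficients,
  the equation \<open>i\<^sub>D \<Omega> = \<alpha>\<close> forces the coefficients \<open>c i\<close> to be linear. For \<open>n = 3\<close>, \<open>D = X\<close>.
\<close>

definition type2 :: "((nat \<Rightarrow> 'a::euclidean_space) \<Rightarrow> real) \<Rightarrow> 'a form2 \<Rightarrow> bool" where
  "type2 \<Omega> \<alpha> \<longleftrightarrow> 3 \<le> DIM('a) \<and>
     (\<exists>D. (\<forall>p u w. contraction (D p) \<Omega> u w = \<alpha> p u w) \<and>
       (\<exists>e x X (c :: nat \<Rightarrow> real \<Rightarrow> real \<Rightarrow> real \<Rightarrow> real).
          linear_coordinates e x \<and>
          (\<forall>p. X p = (\<Sum>i<3. c i (x 0 p) (x 1 p) (x 2 p) *\<^sub>R e i)) \<and>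
          (\<forall>p. D p = wedge_vectors (\<lambda>i. if i < DIM('a) - 3 then e (i + 3) else X p))))"

text \<open>
  The coordinates are named \<open>x = x 0\<close>, \<open>y\<^sub>i = x i\<close> for \<open>1 \<le> i \<le> r\<close>, and, if \<open>\<epsilon> = 1\<close>,
  \<open>z = x (r + 1)\<close>; the remaining ones are the \<open>t\<^sub>j\<close>. The signs are \<open>\<sigma> i\<close>.
\<close>

definition normal_q ::
    "nat \<Rightarrow> nat \<Rightarrow> (nat \<Rightarrow> real) \<Rightarrow> (nat \<Rightarrow> 'a \<Rightarrow> real) \<Rightarrow> 'a \<Rightarrow> real" where
  "normal_q r \<epsilon> \<sigma> x p =
     (\<Sum>i=1..r. \<sigma> i * (x i p)\<^sup>2 / 2) + real \<epsilon> * x 0 p * x (r + 1) p"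

definition normal_coordinates ::
    "nat \<Rightarrow> nat \<Rightarrow> (nat \<Rightarrow> real) \<Rightarrow> (nat \<Rightarrow> 'a::euclidean_space) \<Rightarrow>
     (nat \<Rightarrow> 'a \<Rightarrow> real) \<Rightarrow> bool" where
  "normal_coordinates r \<epsilon> \<sigma> e x \<longleftrightarrow>
     linear_coordinates e x \<and> \<epsilon> \<in> {0, 1} \<and> 1 + r + \<epsilon> \<le> DIM('a) \<and>
     (\<forall>i\<in>{1..r}. \<sigma> i \<in> {-1, 1})"

definition type1_with :: "nat \<Rightarrow> nat \<Rightarrow> 'a::euclidean_space form2 \<Rightarrow> bool" where
  "type1_with r \<epsilon> \<alpha> \<longleftrightarrow>
     (\<exists>\<sigma> e x. normal_coordinates r \<epsilon> \<sigma> e x \<and>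
        \<alpha> = wedge11 (d0 (x 0)) (d0 (normal_q r \<epsilon> \<sigma> x)))"

definition type1 :: "'a::euclidean_space form2 \<Rightarrow> bool" where
  "type1 \<alpha> \<longleftrightarrow> (\<exists>r \<epsilon>. type1_with r \<epsilon> \<alpha>)"

end

theory Submission
  imports Defs
begin

text \<open>
  Write \<open>\<omega> p v = W p p v\<close> with \<open>W\<close> trilinear and symmetric in its first two arguments. Then
  \<open>d\<omega>\<close> is the linear family of constant 2-forms \<open>A p v w = 2 * (W p v w - W p w v)\<close>, and the whole
  proof is linear algebra with \<open>W\<close> and \<open>A\<close>, together with the remark that a continuous function
  that vanishes off a hyperplane vanishes everywhere.

  Differentiating \<open>\<omega> \<and> d\<omega> = 0\<close> gives \<open>d\<omega> \<and> d\<omega> = 0\<close>, so every \<open>A p\<close> is decomposable: nonzero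
  ones correspond to planes in the dual space, and since \<open>A (p + q)\<close> is again decomposable, any two of
  these planes meet in a line. Planes that meet pairwise in lines either all contain a common line or all lie in a common
  three-dimensional space (\<open>decomposable_family_cases\<close>). These are types 1 and 2.

  Three-dimensional case. If \<open>v\<close> lies in the radical of \<open>d\<omega>\<close>, contracting \<open>\<omega> \<and> d\<omega> = 0\<close> with
  \<open>v\<close> leaves \<open>\<omega>(v) d\<omega> = 0\<close>, hence \<open>\<omega>(v) = 0\<close> unless \<open>d\<omega> = 0\<close>; by Cartan's formula \<open>\<omega>\<close> is
  then also invariant under translation along \<open>v\<close> (\<open>radical_imp_form_eq_0\<close>). So \<open>\<omega>\<close> descends to
  the quotient by the radical, here of dimension at most three. For \<open>d\<omega>\<close> of type 2 the radical
  contains the fields \<open>\<partial>/\<partial>x\<^sub>i\<close> that are factors of \<open>D\<close>, which leaves the three other coordinates.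

  Common factor. Here \<open>A p = u \<and> b(p, _)\<close> for a linear function \<open>u\<close>, and closedness of \<open>d\<omega>\<close>
  allows \<open>b\<close> to be chosen symmetric, so that \<open>d\<omega> = du \<and> dq\<close> with \<open>q p = b p p / 2\<close>. Now
  \<open>\<omega> - u dq\<close> is closed, so it is \<open>df\<close> with \<open>f\<close> a cubic form, and integrability says that
  \<open>df \<and> du \<and> dq = 0\<close>. If \<open>b\<close> has rank at least two modulo \<open>u\<close>, a divisibility argument shows
  that \<open>f\<close> is a combination of \<open>u\<^sup>3\<close> and \<open>u q\<close>, which is the asserted formula
  (\<open>form_of_common_factor\<close>). If the rank is one, the radical of \<open>d\<omega>\<close> has codimension two and the
  previous paragraph applies; if it is zero, \<open>d\<omega> = 0\<close> and \<open>\<omega> = df\<close>. So \<open>\<omega>\<close> is a pull-back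
  from the plane in each case, and a fortiori from three-space, all forms on the plane being integrable.
\<close>

section \<open>Smooth maps\<close>

lemma Ck_Suc_imp_Ck: "Ck (Suc k) f \<Longrightarrow> Ck k f"
proof (induction k arbitrary: f)
  case 0
  then show ?case
    by (auto intro!: continuous_at_imp_continuous_on differentiable_imp_continuous_within)
next
  case (Suc k)
  then show ?case by (metis Ck.simps(2))
qed

lemma Ck_SucI:
  assumes "\<And>p. (f has_derivative f' p) (at p)" and "\<And>v. Ck k (\<lambda>p. f' p v)"
  shows "Ck (Suc k) f"
proof -
  have "frechet_derivative f (at p) = f' p" for p
    using assms(1) by (metis frechet_derivative_at)
  then show ?thesis using assms by (auto simp: differentiable_def)
qed

lemma Ck_const: "Ck k (\<lambda>p::'a::euclidean_space. c::'b::euclidean_space)"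
proof (induction k arbitrary: c)
  case (Suc k)
  then show ?case by (intro Ck_SucI[where f' = "\<lambda>p v. 0"]) auto
qed auto

lemma Ck_linear:
  assumes "linear f"
  shows "Ck k f"
proof (cases k)
  case 0
  then show ?thesis using assms by (simp add: linear_continuous_on linear_conv_bounded_linear)
next
  case (Suc m)
  have "Ck (Suc m) f"
    by (rule Ck_SucI[where f' = "\<lambda>p. f"])
       (use assms in \<open>auto intro: linear_imp_has_derivative Ck_const\<close>)
  then show ?thesis using Suc by simp
qed

lemma Ck_add:
  assumes "Ck k f" "Ck k g"
  shows "Ck k (\<lambda>p. f p + g p)"
  using assms
proof (induction k arbitrary: f g)
  case 0
  then show ?case by (simp add: continuous_on_add)
next
  case (Suc k)
  then show ?case
    by (intro Ck_SucI[where f' = "\<lambda>p v. frechet_derivative f (at p) v + frechet_derivative g (at p) v"])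
       (auto intro!: derivative_eq_intros simp: frechet_derivative_works[symmetric])
qed

text \<open>
  The Leibniz rule in every order. It is stated for an arbitrary bilinear map because it serves
  products, scalar multiples of vectors, inner products and polarized quadratic forms.
\<close>

lemma Ck_bilinear:
  assumes B: "bounded_bilinear B" and "Ck k f" "Ck k g"
  shows "Ck k (\<lambda>p. B (f p) (g p))"
  using assms(2,3)
proof (induction k arbitrary: f g)
  case 0
  then show ?case using bounded_bilinear.continuous_on[OF B] by auto
next
  case (Suc k)
  have "Ck k f" "Ck k g" using Suc.prems Ck_Suc_imp_Ck by blast+
  with Suc show ?case
    by (intro Ck_SucI[where f' = "\<lambda>p v. B (f p) (frechet_derivative g (at p) v)
                                     + B (frechet_derivative f (at p) v) (g p)"])
       (auto intro!: bounded_bilinear.FDERIV[OF B] Ck_add simp: frechet_derivative_works[symmetric])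
qed

lemma Ck_compose_linear:
  assumes L: "linear L" and "Ck k f"
  shows "Ck k (\<lambda>p. f (L p))"
  using assms(2)
proof (induction k arbitrary: f)
  case 0
  then show ?case
    using L by (auto intro!: continuous_on_compose2[of UNIV f] simp: linear_continuous_on linear_conv_bounded_linear)
next
  case (Suc k)
  show ?case
  proof (rule Ck_SucI[where f' = "\<lambda>p v. frechet_derivative f (at (L p)) (L v)"])
    fix p
    have "(f has_derivative frechet_derivative f (at (L p))) (at (L p))"
      using Suc.prems by (simp add: frechet_derivative_works[symmetric])
    then show "((\<lambda>p. f (L p)) has_derivative (\<lambda>v. frechet_derivative f (at (L p)) (L v))) (at p)"
      using has_derivative_compose[OF linear_imp_has_derivative[OF L]] by blast
  qed (use Suc in auto)
qed

lemma smooth_const: "smooth (\<lambda>p. c)"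
  by (simp add: smooth_def Ck_const)

lemma smooth_linear: "linear f \<Longrightarrow> smooth f"
  by (simp add: smooth_def Ck_linear)

lemma smooth_add: "smooth f \<Longrightarrow> smooth g \<Longrightarrow> smooth (\<lambda>p. f p + g p)"
  by (simp add: smooth_def Ck_add)

lemma smooth_bilinear:
  "bounded_bilinear B \<Longrightarrow> smooth f \<Longrightarrow> smooth g \<Longrightarrow> smooth (\<lambda>p. B (f p) (g p))"
  by (simp add: smooth_def Ck_bilinear)

lemma smooth_compose_linear: "linear L \<Longrightarrow> smooth f \<Longrightarrow> smooth (\<lambda>p. f (L p))"
  unfolding smooth_def using Ck_compose_linear by blast

lemmas smooth_mult = smooth_bilinear[OF bounded_bilinear_mult]
  and smooth_scaleR = smooth_bilinear[OF bounded_bilinear_scaleR]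

lemma smooth_differentiable: "smooth f \<Longrightarrow> f differentiable (at p)"
  unfolding smooth_def by (metis Ck.simps(2))

lemma smooth_sum:
  assumes "finite I" "\<And>i. i \<in> I \<Longrightarrow> smooth (g i)"
  shows "smooth (\<lambda>p. \<Sum>i\<in>I. g i p)"
  using assms by (induction I rule: finite_induct) (auto intro: smooth_const smooth_add)

section \<open>One-forms under linear maps\<close>

lemma d1_linear_pullback:
  fixes M :: "'a::euclidean_space \<Rightarrow> 'b::euclidean_space"
  assumes M: "linear M" and "smooth_form1 \<eta>"
  shows "d1 (\<lambda>p v. \<eta> (M p) (M v)) p u v = d1 \<eta> (M p) (M u) (M v)"
proof -
  have "frechet_derivative (\<lambda>p. \<eta> (M p) c) (at p) = (\<lambda>h. frechet_derivative (\<lambda>p. \<eta> p c) (at (M p)) (M h))" for c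
  proof (rule frechet_derivative_at[symmetric])
    have "((\<lambda>p. \<eta> p c) has_derivative frechet_derivative (\<lambda>p. \<eta> p c) (at (M p))) (at (M p))"
      using assms(2) smooth_differentiable
      by (auto simp: smooth_form1_def frechet_derivative_works[symmetric])
    then show "((\<lambda>p. \<eta> (M p) c) has_derivative (\<lambda>h. frechet_derivative (\<lambda>p. \<eta> p c) (at (M p)) (M h))) (at p)"
      using has_derivative_compose[OF linear_imp_has_derivative[OF M]] by blast
  qed
  then show ?thesis by (simp add: d1_def)
qed

text \<open>
  The first term of \<open>d1\<close> is linear in \<open>u\<close> as a derivative in direction \<open>u\<close>. In the second one
  \<open>u\<close> selects the coefficient that is differentiated, and linearity is inherited from \<open>\<eta> p\<close>.
\<close>

lemma linear_d1:
  assumes "smooth_form1 \<eta>"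
  shows "linear (\<lambda>u. d1 \<eta> p u v)"
proof -
  have diff: "(\<lambda>p. \<eta> p c) differentiable (at p)" for c
    using assms by (simp add: smooth_form1_def smooth_differentiable)
  have lin: "linear (\<eta> q)" for q using assms by (simp add: smooth_form1_def)
  have d: "((\<lambda>p. \<eta> p c) has_derivative frechet_derivative (\<lambda>p. \<eta> p c) (at p)) (at p)" for c
    using diff by (simp add: frechet_derivative_works[symmetric])
  have "frechet_derivative (\<lambda>p. \<eta> p (a + b)) (at p) v =
      frechet_derivative (\<lambda>p. \<eta> p a) (at p) v + frechet_derivative (\<lambda>p. \<eta> p b) (at p) v" for a b
  proof -
    have "((\<lambda>p. \<eta> p a + \<eta> p b) has_derivative (\<lambda>v. frechet_derivative (\<lambda>p. \<eta> p a) (at p) v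
        + frechet_derivative (\<lambda>p. \<eta> p b) (at p) v)) (at p)"
      by (intro has_derivative_add d)
    from frechet_derivative_at[OF this] show ?thesis by (simp add: linear_add[OF lin] fun_eq_iff)
  qed
  moreover have "frechet_derivative (\<lambda>p. \<eta> p (r *\<^sub>R a)) (at p) v =
      r * frechet_derivative (\<lambda>p. \<eta> p a) (at p) v" for a r
  proof -
    have "((\<lambda>p. r * \<eta> p a) has_derivative (\<lambda>v. r * frechet_derivative (\<lambda>p. \<eta> p a) (at p) v)) (at p)"
      by (intro has_derivative_mult_right d)
    from frechet_derivative_at[OF this] show ?thesis by (simp add: linear_scale[OF lin] fun_eq_iff)
  qed
  moreover have l: "linear (frechet_derivative (\<lambda>p. \<eta> p v) (at p))"
    using diff linear_frechet_derivative by blast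
  ultimately show ?thesis
    by (intro linearI) (simp_all add: d1_def linear_add[OF l] linear_scale[OF l] right_diff_distrib)
qed

lemma linear_on_plane:
  assumes "linear (f :: real^2 \<Rightarrow> real)"
  shows "f v = v $ 1 * f (axis 1 1) + v $ 2 * f (axis 2 1)"
proof -
  have "v = v $ 1 *\<^sub>R axis 1 1 + v $ 2 *\<^sub>R axis 2 1"
    by (simp add: vec_eq_iff forall_2 axis_def)
  then have "f v = f (v $ 1 *\<^sub>R axis 1 1 + v $ 2 *\<^sub>R axis 2 1)" by simp
  also have "\<dots> = v $ 1 * f (axis 1 1) + v $ 2 * f (axis 2 1)"
    by (simp only: linear_add[OF assms] linear_scale[OF assms] real_scaleR_def)
  finally show ?thesis .
qed

text \<open>
  There are no nonzero alternating 3-forms on a two-dimensional space.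
\<close>

lemma integrable_form1_plane:
  fixes \<eta> :: "(real^2) form1"
  assumes "smooth_form1 \<eta>"
  shows "integrable_form1 \<eta>"
  unfolding integrable_form1_def wedge12_def
proof (intro allI)
  fix p u v w
  let ?a = "d1 \<eta> p (axis 1 1) (axis 2 1)"
  have d: "d1 \<eta> p u v = (u $ 1 * v $ 2 - u $ 2 * v $ 1) * ?a" for u v
  proof -
    have l: "d1 \<eta> p v w = v $ 1 * d1 \<eta> p (axis 1 1) w + v $ 2 * d1 \<eta> p (axis 2 1) w" for v w
      by (rule linear_on_plane[OF linear_d1[OF assms]])
    have skew: "d1 \<eta> p v w = - d1 \<eta> p w v" and diag: "d1 \<eta> p w w = 0" for v w
      by (simp_all add: d1_def)
    have "d1 \<eta> p (axis 1 1) v = v $ 2 * ?a" "d1 \<eta> p (axis 2 1) v = - (v $ 1 * ?a)"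
      using l[of v "axis 1 1"] l[of v "axis 2 1"] skew[of v "axis 1 1"] skew[of v "axis 2 1"]
        skew[of "axis 2 1" "axis 1 1"] diag[of "axis 1 1"] diag[of "axis 2 1"]
      by (simp_all del: mult_minus_right)
    then show ?thesis by (subst l) (simp add: algebra_simps)
  qed
  have "linear (\<eta> p)" using assms by (simp add: smooth_form1_def)
  from linear_on_plane[OF this]
  have e: "\<eta> p v = v $ 1 * \<eta> p (axis 1 1) + v $ 2 * \<eta> p (axis 2 1)" for v .
  show "\<eta> p u * d1 \<eta> p v w + \<eta> p v * d1 \<eta> p w u + \<eta> p w * d1 \<eta> p u v = 0"
    unfolding d[of v w] d[of w u] d[of u v] e[of u] e[of v] e[of w]
    by (simp add: algebra_simps)
qed

text \<open>
  Embed the plane in three-space by \<open>\<iota>\<close> and extend \<open>\<eta>\<close> to be constant along the fibres of the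
  projection \<open>\<pi>\<close>. The extension stays integrable because \<open>d\<close> commutes with pull-back along \<open>\<pi>\<close>.
\<close>

lemma plane_pullback_imp_space_pullback:
  fixes F :: "'a::euclidean_space \<Rightarrow> real^2"
  assumes F: "smooth F" and \<eta>: "smooth_form1 \<eta>"
  shows "\<exists>(G :: 'a \<Rightarrow> real^3) \<zeta>. smooth G \<and> smooth_form1 \<zeta> \<and> integrable_form1 \<zeta> \<and>
           pullback F \<eta> = pullback G \<zeta>"
proof -
  define \<iota> :: "real^2 \<Rightarrow> real^3" where "\<iota> P = P $ 1 *\<^sub>R axis 1 1 + P $ 2 *\<^sub>R axis 2 1" for P
  define \<pi> :: "real^3 \<Rightarrow> real^2" where "\<pi> P = P $ 1 *\<^sub>R axis 1 1 + P $ 2 *\<^sub>R axis 2 1" for P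
  have lin: "linear \<iota>" "linear \<pi>" by (auto simp: \<iota>_def \<pi>_def linear_iff algebra_simps)
  have \<pi>\<iota>: "\<pi> (\<iota> P) = P" for P by (simp add: \<iota>_def \<pi>_def vec_eq_iff forall_2 axis_def)
  define \<zeta> where "\<zeta> p v = \<eta> (\<pi> p) (\<pi> v)" for p v
  have *: "smooth (\<lambda>p. F p $ i)" for i
    using smooth_bilinear[OF bounded_bilinear_inner F smooth_const[of "axis i 1"]]
    by (simp add: inner_axis)
  have "smooth (\<lambda>p. \<iota> (F p))"
    unfolding \<iota>_def
    by (rule smooth_add[OF smooth_scaleR[OF * smooth_const] smooth_scaleR[OF * smooth_const]])
  moreover have "smooth_form1 \<zeta>"
    unfolding smooth_form1_def
  proof (intro conjI allI)
    have "linear (\<eta> (\<pi> p))" for p using \<eta> by (simp add: smooth_form1_def)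
    from linear_compose[OF lin(2) this] show "linear (\<zeta> p)" for p
      by (simp add: \<zeta>_def[abs_def] o_def)
    have "smooth (\<lambda>p. \<eta> p v)" for v using \<eta> by (simp add: smooth_form1_def)
    from smooth_compose_linear[OF lin(2) this] show "smooth (\<lambda>p. \<zeta> p v)" for v
      by (simp add: \<zeta>_def)
  qed
  moreover have "integrable_form1 \<zeta>"
  proof -
    have d: "d1 \<zeta> p u v = d1 \<eta> (\<pi> p) (\<pi> u) (\<pi> v)" for p u v
      unfolding \<zeta>_def[abs_def] by (rule d1_linear_pullback[OF lin(2) \<eta>])
    have "wedge12 \<zeta> (d1 \<zeta>) p u v w = wedge12 \<eta> (d1 \<eta>) (\<pi> p) (\<pi> u) (\<pi> v) (\<pi> w)" for p u v w
      unfolding wedge12_def d by (simp add: \<zeta>_def)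
    then show ?thesis
      using integrable_form1_plane[OF \<eta>] by (simp add: integrable_form1_def)
  qed
  moreover have "pullback F \<eta> = pullback (\<lambda>p. \<iota> (F p)) \<zeta>"
  proof -
    have "frechet_derivative (\<lambda>p. \<iota> (F p)) (at p) = (\<lambda>v. \<iota> (frechet_derivative F (at p) v))" for p
      by (rule frechet_derivative_at[symmetric])
         (rule bounded_linear.has_derivative[OF lin(1)[unfolded linear_conv_bounded_linear]
              iffD1[OF frechet_derivative_works smooth_differentiable[OF F]]])
    then show ?thesis by (simp add: pullback_def \<zeta>_def \<pi>\<iota> fun_eq_iff)
  qed
  ultimately show ?thesis by blast
qed

section \<open>Linear families of decomposable 2-forms\<close>

text \<open>
  A linear space of decomposable 2-forms consists either of products with one fixed linear function or of forms
  in three variables. The hypothesis \<open>wedge\<close> is the polarization of \<open>\<alpha> \<and> \<alpha> = 0\<close>.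

  Take a member \<open>a\<close> with \<open>a s t = 1\<close> and let \<open>N\<close> be its radical, a complement of the span of
  \<open>s\<close> and \<open>t\<close>. Every member vanishes on \<open>N \<times> N\<close>, so it is determined, up to a multiple of \<open>a\<close>, by
  the linear map \<open>n \<mapsto> (A q s n, A q t n)\<close> from \<open>N\<close> to the plane. These maps form a linear space of
  maps of rank at most one; hence either their images lie in a common line (a common factor), or their
  kernels contain a common hyperplane \<open>K\<close> of \<open>N\<close> (three variables).
\<close>

lemma decomposable_family_cases:
  fixes A :: "'i \<Rightarrow> 'a::real_vector \<Rightarrow> 'a \<Rightarrow> real"
  assumes lin: "\<And>q v. linear (A q v)"
    and skew: "\<And>q v w. A q v w = - A q w v"
    and wedge: "\<And>q r u v w z. A q u v * A r w z - A q u w * A r v z + A q u z * A r v w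
                         + A r u v * A q w z - A r u w * A q v z + A r u z * A q v w = 0"
  obtains
    (common_factor) u t where "linear u" "u t = 1"
      "\<And>q v w. A q v w = u v * A q t w - u w * A q t v"
  | (three_variables) l1 l2 l3 s1 s2 s3 where "linear l1" "linear l2" "linear l3"
      "\<And>q v w. A q (v - (l1 v *\<^sub>R s1 + l2 v *\<^sub>R s2 + l3 v *\<^sub>R s3)) w = 0"
proof (cases "\<forall>q v w. A q v w = 0")
  case True
  then show thesis
    by (intro three_variables[of "\<lambda>_. 0" "\<lambda>_. 0" "\<lambda>_. 0"]) (simp_all add: linear_iff)
next
  case False
  then obtain q0 s t' where "A q0 s t' \<noteq> 0" by blast
  define t where "t = t' /\<^sub>R A q0 s t'"
  define a where "a = A q0"
  have R [simp]: "A q v (x + y) = A q v x + A q v y" "A q v (x - y) = A q v x - A q v y"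
    "A q v (r *\<^sub>R x) = r * A q v x" for q v x y r
    by (simp_all add: linear_add[OF lin] linear_diff[OF lin] linear_scale[OF lin])
  have L [simp]: "A q (x + y) v = A q x v + A q y v" "A q (x - y) v = A q x v - A q y v"
    "A q (r *\<^sub>R x) v = r * A q x v" for q v x y r
    using skew[of q _ v] by simp_all
  have diag [simp]: "A q v v = 0" for q v using skew[of q v v] by simp
  note aR = R[of q0, folded a_def] and aL = L[of q0, folded a_def]
    and adiag = diag[of q0, folded a_def] and askew = skew[of q0, folded a_def]
  have st: "a s t = 1" "a t s = -1"
    using \<open>A q0 s t' \<noteq> 0\<close> askew[of t s] by (simp_all add: a_def t_def)
  have NN: "A q n n' = 0" if "a s n = 0" "a t n = 0" "a s n' = 0" "a t n' = 0" for q n n'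
  proof -
    have "a n n' = 0" using wedge[of q0 s t q0 n n', folded a_def] that st by simp
    then show ?thesis using wedge[of q0 s t q n n', folded a_def] that st by simp
  qed
  \<comment> \<open>the polarized vanishing of the two-by-two minors of \<open>n \<mapsto> (A q s n, A q t n)\<close>\<close>
  have minor: "A q s n * A r t n' + A r s n * A q t n' = A q s n' * A r t n + A r s n' * A q t n"
    if "a s n = 0" "a t n = 0" "a s n' = 0" "a t n' = 0" for q r n n'
    using wedge[of q s t r n n'] NN[OF that, of q] NN[OF that, of r] by simp
  show thesis
  proof (cases "\<exists>c d. (c, d) \<noteq> (0, 0) \<and>
      (\<forall>q n. a s n = 0 \<longrightarrow> a t n = 0 \<longrightarrow> c * A q s n + d * A q t n = 0)")
    case True
    then obtain c d where cd: "(c, d) \<noteq> (0, 0)"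
      and ann: "\<And>q n. a s n = 0 \<Longrightarrow> a t n = 0 \<Longrightarrow> c * A q s n + d * A q t n = 0" by blast
    \<comment> \<open>Change the basis of the span of \<open>s\<close> and \<open>t\<close> so that its first vector \<open>s2\<close> pairs
      to zero with \<open>N\<close>; \<open>D\<close> keeps \<open>a s2 t2 = 1\<close>. The common factor is \<open>a s2\<close>.\<close>
    define D where "D = c\<^sup>2 + d\<^sup>2"
    have D: "D \<noteq> 0" using cd by (auto simp: D_def sum_power2_eq_zero_iff)
    define s2 where "s2 = c *\<^sub>R s + d *\<^sub>R t"
    define t2 where "t2 = (c / D) *\<^sub>R t - (d / D) *\<^sub>R s"
    have st2: "a s2 t2 = 1" 
      using D st adiag by (simp add: s2_def t2_def aR aL field_simps) (simp add: D_def power2_eq_square)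
    have ts2: "a t2 s2 = -1" using st2 askew[of t2 s2] by simp
    define N where "N v = v - a v t2 *\<^sub>R s2 - a s2 v *\<^sub>R t2" for v
    have dec: "v = a v t2 *\<^sub>R s2 + a s2 v *\<^sub>R t2 + N v" for v by (simp add: N_def)
    have N: "a s (N v) = 0" "a t (N v) = 0" for v
    proof -
      have "a s2 (N v) = 0" "a t2 (N v) = 0"
        using st2 ts2 askew[of t2 v] by (simp_all add: N_def aR adiag)
      then have *: "c * a s (N v) + d * a t (N v) = 0" "c * a t (N v) = d * a s (N v)"
        using D by (simp_all add: s2_def t2_def aL field_simps)
      have "D * a s (N v) = c * (c * a s (N v) + d * a t (N v)) - d * (c * a t (N v) - d * a s (N v))"
        "D * a t (N v) = d * (c * a s (N v) + d * a t (N v)) + c * (c * a t (N v) - d * a s (N v))"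
        by (simp_all add: D_def power2_eq_square algebra_simps)
      then have "D * a s (N v) = 0" "D * a t (N v) = 0"
        by (simp_all only: * diff_self mult_zero_right add_0)
      then show "a s (N v) = 0" "a t (N v) = 0" using D by simp_all
    qed
    have s2N: "A q s2 (N v) = 0" "A q (N v) s2 = 0" "A q (N v) (N w) = 0" for q v w
      using ann[OF N] NN[OF N N] skew[of q "N v" s2] by (simp_all add: s2_def)
    have "A q v w = a s2 v * A q t2 w - a s2 w * A q t2 v" for q v w
    proof -
      have e: "A q x w = A q x (a w t2 *\<^sub>R s2 + a s2 w *\<^sub>R t2 + N w)" for x w
        by (simp only: dec[symmetric])
      have "A q v w = A q (a v t2 *\<^sub>R s2 + a s2 v *\<^sub>R t2 + N v) (a w t2 *\<^sub>R s2 + a s2 w *\<^sub>R t2 + N w)"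
        by (simp only: dec[symmetric])
      also have "\<dots> = a s2 v * A q t2 w - a s2 w * A q t2 v"
        unfolding e[of t2 w] e[of t2 v] using s2N skew[of q t2 s2] skew[of q t2 "N v"]
        by (simp add: algebra_simps)
      finally show ?thesis .
    qed
    from common_factor[OF _ st2 this] show thesis using lin by (simp add: a_def)
  next
    case False
    then have ex: "\<exists>q n. a s n = 0 \<and> a t n = 0 \<and> c * A q s n + d * A q t n \<noteq> 0"
      if "(c, d) \<noteq> (0, 0)" for c d using that by blast
    \<comment> \<open>The images are not all in the line through \<open>(A q1 s n1, A q1 t n1)\<close>, so \<open>q2, n2\<close> give a
      second direction.\<close>
    from ex[of 0 1] obtain q1 n1 where n1: "a s n1 = 0" "a t n1 = 0" and x2: "A q1 t n1 \<noteq> 0"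
      by auto
    from ex[of "A q1 t n1" "- A q1 s n1"] x2 obtain q2 n2 where n2: "a s n2 = 0" "a t n2 = 0"
      and det: "A q1 t n1 * A q2 s n2 - A q1 s n1 * A q2 t n2 \<noteq> 0"
      by auto
    have parallel: "f = 0 \<and> g = 0"
      if "f * A q1 t n1 = A q1 s n1 * g" "f * A q2 t n2 = A q2 s n2 * g" for f g
    proof -
      have "(A q1 t n1 * A q2 s n2 - A q1 s n1 * A q2 t n2) * g
          = A q1 t n1 * (A q2 s n2 * g) - A q2 t n2 * (A q1 s n1 * g)"
        by (simp add: algebra_simps)
      also have "\<dots> = 0" unfolding that[symmetric] by simp
      finally have "g = 0" using det by simp
      then show ?thesis using that x2 by simp
    qed
    define N where "N v = v - a v t *\<^sub>R s - a s v *\<^sub>R t" for v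
    define l where "l v = A q1 t (N v) / A q1 t n1" for v
    define K where "K v = N v - l v *\<^sub>R n1" for v
    have N: "a s (N v) = 0" "a t (N v) = 0" for v
      using st askew[of t v] by (simp_all add: N_def aR adiag)
    have K: "a s (K v) = 0" "a t (K v) = 0" for v
      using N n1 by (simp_all add: K_def aR)
    have K1: "A q1 t (K v) = 0" "A q1 s (K v) = 0" for v
    proof -
      show *: "A q1 t (K v) = 0" using x2 by (simp add: K_def l_def)
      show "A q1 s (K v) = 0" using minor[OF K n1, of q1 v q1] * x2 by simp
    qed
    \<comment> \<open>On \<open>K\<close> the member \<open>q1\<close> vanishes, so the polarized minor with \<open>n1\<close> forces every image
      into the first direction; likewise \<open>q2\<close> forces it into the second.\<close>
    have Kq: "A q s (K v) * A q1 t n1 = A q1 s n1 * A q t (K v)" for q v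
      using minor[OF K n1, of q v q1] K1 by simp
    have "A q2 s (K v) * A q2 t n2 = A q2 s n2 * A q2 t (K v)" for v
      using minor[OF K n2, of q2 v q2] by (simp add: mult.commute)
    with Kq parallel have K2: "A q2 t (K v) = 0" "A q2 s (K v) = 0" for v by blast+
    have "A q s (K v) * A q2 t n2 = A q2 s n2 * A q t (K v)" for q v
      using minor[OF K n2, of q v q2] K2 by simp
    with Kq parallel have Kst: "A q t (K v) = 0" "A q s (K v) = 0" for q v by blast+
    have K0: "A q (K v) w = 0" for q v w
    proof -
      have "A q (K v) w = A q (K v) (a w t *\<^sub>R s + a s w *\<^sub>R t + N w)" by (simp add: N_def)
      then show ?thesis
        using Kst[of q v] skew[of q "K v" s] skew[of q "K v" t] NN[OF K N] by simp
    qed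
    have "linear (\<lambda>v. a v t)" by (intro linearI) (simp_all add: aL)
    moreover have "linear (a s)" using lin by (simp add: a_def)
    moreover have "linear l"
      by (intro linearI) (simp_all add: l_def N_def aL aR field_simps add_divide_distrib diff_divide_distrib)
    moreover have "A q (v - (a v t *\<^sub>R s + a s v *\<^sub>R t + l v *\<^sub>R n1)) w = 0" for q v w
      using K0[of q v w] by (simp add: K_def N_def algebra_simps)
    ultimately show thesis by (rule three_variables)
  qed
qed

section \<open>Quadratic 1-forms and their polar forms\<close>

text \<open>
  The complement of a hyperplane is dense. Only one line transversal to it is used, so the lemma also
  serves when \<open>f * l\<close> is known to vanish merely on a subspace that contains the line.
\<close>

lemma continuous_zero_of_zero_off_hyperplane:
  fixes f :: "'a::euclidean_space \<Rightarrow> real"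
  assumes "continuous_on UNIV f" and l: "linear l" "l m \<noteq> 0"
    and zero: "\<And>t. f (p + t *\<^sub>R m) * l (p + t *\<^sub>R m) = 0"
  shows "f p = 0"
proof (cases "l p = 0")
  case False
  then show ?thesis using zero[of 0] by simp
next
  case True
  have "f (p + t *\<^sub>R m) = 0" if "t \<noteq> 0" for t
    using zero[of t] that True l by (simp add: linear_add linear_scale)
  then have "((\<lambda>t. f (p + t *\<^sub>R m)) \<longlongrightarrow> 0) (at 0)"
    by (intro tendsto_eventually) (simp add: eventually_at_filter)
  moreover have "((\<lambda>t. f (p + t *\<^sub>R m)) \<longlongrightarrow> f (p + 0 *\<^sub>R m)) (at 0)"
    using assms(1) by (intro isCont_tendsto_compose[of _ f] tendsto_intros)
      (simp add: continuous_on_eq_continuous_at)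
  ultimately show ?thesis using LIM_unique by force
qed

lemma linear_basis_expansion:
  fixes f :: "'a::euclidean_space \<Rightarrow> real"
  assumes "linear f"
  shows "f x = (\<Sum>b\<in>Basis. (x \<bullet> b) * f b)"
proof -
  have "f x = f (\<Sum>b\<in>Basis. (x \<bullet> b) *\<^sub>R b)" by (simp only: euclidean_representation)
  also have "\<dots> = (\<Sum>b\<in>Basis. (x \<bullet> b) * f b)"
    by (simp only: linear_sum[OF assms] linear_scale[OF assms] real_scaleR_def)
  finally show ?thesis .
qed

text \<open>
  The 1-form \<open>\<lambda>p v. W p p v\<close> with quadratic coefficients, given by its polar form. Its exterior
  derivative is linear in the point, and the arguments below use it at arbitrary points as a bilinear
  object, which is why \<open>W\<close> and not the 1-form is the primary datum.
\<close>

locale polar_form =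
  fixes W :: "'a::euclidean_space \<Rightarrow> 'a \<Rightarrow> 'a \<Rightarrow> real"
  assumes linear_fst: "linear (\<lambda>p. W p q v)"
    and linear_form: "linear (W p q)"
    and W_sym: "W p q v = W q p v"
begin

definition form :: "'a form1" where "form p v = W p p v"

definition dform :: "'a form2" where "dform p v w = 2 * (W p v w - W p w v)"

lemma linear_snd: "linear (\<lambda>q. W p q v)"
  using linear_fst[of p v] by (simp add: W_sym)

lemmas W_linear =
  linear_add[OF linear_fst] linear_add[OF linear_snd] linear_add[OF linear_form]
  linear_diff[OF linear_fst] linear_diff[OF linear_snd] linear_diff[OF linear_form]
  linear_scale[OF linear_fst] linear_scale[OF linear_snd] linear_scale[OF linear_form]

lemma linear_dform: "linear (\<lambda>p. dform p v w)" "linear (dform p v)"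
  by (intro linearI; simp add: dform_def W_linear algebra_simps)+

lemma dform_skew: "dform p v w = - dform p w v"
  by (simp add: dform_def)

lemma dform_closed: "dform p v w + dform v w p + dform w p v = 0"
  using W_sym by (simp add: dform_def)

lemma bounded_bilinear_W: "bounded_bilinear (\<lambda>p q. W p q v)"
  by (simp add: bilinear_conv_bounded_bilinear[symmetric] bilinear_def linear_fst linear_snd)

lemma d1_form: "d1 form = dform"
proof -
  have "((\<lambda>p. form p v) has_derivative (\<lambda>h. W p h v + W h p v)) (at p)" for p v
    unfolding form_def
    by (rule bounded_bilinear.FDERIV[OF bounded_bilinear_W has_derivative_ident has_derivative_ident])
  then have "frechet_derivative (\<lambda>p. form p v) (at p) = (\<lambda>h. W p h v + W h p v)" for p v
    by (metis frechet_derivative_at)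
  then show ?thesis
    using W_sym by (simp add: fun_eq_iff d1_def dform_def)
qed

lemma smooth_W: "smooth (\<lambda>p. W p p v)"
  by (rule smooth_bilinear[OF bounded_bilinear_W smooth_linear smooth_linear]) (simp_all add: linear_iff)

lemma smooth_form1_form: "smooth_form1 form"
  using linear_form smooth_W by (simp add: smooth_form1_def form_def[abs_def])

lemma form_eq_0_imp_W_eq_0:
  assumes "\<And>p. form p v = 0"
  shows "W p q v = 0"
  using assms[of "p + q"] assms[of p] assms[of q] W_sym[of q p v]
  by (simp add: form_def W_linear)

text \<open>
  If \<open>d\<omega> = 0\<close> then \<open>W\<close> is symmetric in all three arguments, and Euler's identity gives the cubic
  potential. It is expanded over the basis to reduce to derivatives of the quadratic coefficients.
\<close>

lemma closed_imp_gradient: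
  assumes "\<And>p v w. dform p v w = 0"
  shows "form = d0 (\<lambda>p. W p p p / 3)" "smooth (\<lambda>p. W p p p / 3)"
proof -
  have s: "W p v w = W p w v" for p v w using assms[of p v w] by (simp add: dform_def)
  have e: "W p p p = (\<Sum>b\<in>Basis. (p \<bullet> b) * W p p b)" for p
    by (rule linear_basis_expansion[OF linear_form])
  have "smooth (\<lambda>p::'a. (p \<bullet> b) * W p p b)" for b
    by (intro smooth_mult smooth_W smooth_linear) (simp add: linear_iff inner_add_left)
  then have "smooth (\<lambda>p. (1/3) * W p p p)"
    unfolding e by (intro smooth_mult[OF smooth_const] smooth_sum) auto
  then show "smooth (\<lambda>p. W p p p / 3)" by simp
  show "form = d0 (\<lambda>p. W p p p / 3)"
  proof (intro ext)
    fix p v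
    have "((\<lambda>p. W p p b) has_derivative (\<lambda>h. W p h b + W h p b)) (at p)" for b
      by (rule bounded_bilinear.FDERIV[OF bounded_bilinear_W has_derivative_ident has_derivative_ident])
    then have "((\<lambda>p. (\<Sum>b\<in>Basis. (p \<bullet> b) * W p p b) / 3) has_derivative
        (\<lambda>h. (\<Sum>b\<in>Basis. (p \<bullet> b) * (W p h b + W h p b) + (h \<bullet> b) * W p p b) / 3)) (at p)"
      by (auto intro!: derivative_eq_intros)
    moreover have "(\<Sum>b\<in>Basis. (p \<bullet> b) * (W p h b + W h p b) + (h \<bullet> b) * W p p b) / 3 = W p p h" for h
    proof -
      have x: "(\<Sum>b\<in>Basis. (x \<bullet> b) * W y z b) = W y z x" for x y z
        by (rule linear_basis_expansion[OF linear_form, symmetric])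
      show ?thesis using s[of p h p] W_sym[of h p p]
        by (simp add: sum.distrib distrib_left x)
    qed
    ultimately have "((\<lambda>p. W p p p / 3) has_derivative (\<lambda>h. W p p h)) (at p)"
      by (simp only: e)
    then show "form p v = d0 (\<lambda>p. W p p p / 3) p v"
      unfolding d0_def form_def by (metis frechet_derivative_at)
  qed
qed

lemma polar_form_linear_pullback:
  fixes S :: "'b::euclidean_space \<Rightarrow> 'a"
  assumes "linear S"
  shows "polar_form (\<lambda>P Q V. W (S P) (S Q) (S V))"
  by unfold_locales
     (auto intro!: linearI simp: W_linear linear_add[OF assms] linear_scale[OF assms] W_sym)

end

text \<open>
  The coefficients \<open>c\<close> of a quadratic form need not be symmetric; averaging over the two orders of
  the arguments makes the polar form symmetric without changing its values on the diagonal.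
\<close>

lemma quadratic_form1_polar:
  assumes "quadratic_form1 \<omega>"
  obtains W where "polar_form W" "\<omega> = polar_form.form W"
proof -
  have lin: "linear (\<omega> p)" for p using assms by (simp add: quadratic_form1_def)
  have "\<forall>b\<in>Basis. \<exists>c. \<forall>p. \<omega> p b = (\<Sum>i\<in>Basis. \<Sum>j\<in>Basis. c i j * (p \<bullet> i) * (p \<bullet> j))"
    using assms by (simp add: quadratic_form1_def homogeneous_quadratic_def)
  from bchoice[OF this] obtain c where c: "\<And>p b. b \<in> Basis \<Longrightarrow>
      \<omega> p b = (\<Sum>i\<in>Basis. \<Sum>j\<in>Basis. c b i j * (p \<bullet> i) * (p \<bullet> j))"
    by blast
  define M where "M b p q = (\<Sum>i\<in>Basis. \<Sum>j\<in>Basis. c b i j * (p \<bullet> i) * (q \<bullet> j))" for b p q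
  define W where "W p q v = (\<Sum>b\<in>Basis. (v \<bullet> b) * ((M b p q + M b q p) / 2))" for p q v
  have M1: "M b (p + q) r = M b p r + M b q r" "M b (x *\<^sub>R p) r = x * M b p r" for b p q r x
    unfolding M_def sum.distrib[symmetric] sum_distrib_left
    by (intro sum.cong refl; simp add: algebra_simps)+
  have M2: "M b r (p + q) = M b r p + M b r q" "M b r (x *\<^sub>R p) = x * M b r p" for b p q r x
    unfolding M_def sum.distrib[symmetric] sum_distrib_left
    by (intro sum.cong refl; simp add: algebra_simps)+
  have W: "polar_form W"
  proof (rule polar_form.intro)
    show "linear (\<lambda>p. W p q v)" for q v
      by (intro linearI)
         (simp_all add: W_def M1 M2 sum_distrib_left sum.distrib[symmetric] algebra_simps add_divide_distrib)
    show "linear (W p q)" for p q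
      by (intro linearI)
         (simp_all add: W_def sum_distrib_left sum.distrib[symmetric] inner_add_left distrib_right mult.assoc add_divide_distrib)
    show "W p q v = W q p v" for p q v
      by (simp add: W_def add.commute)
  qed
  moreover have "\<omega> = polar_form.form W"
  proof (intro ext)
    fix p v
    have "\<omega> p v = (\<Sum>b\<in>Basis. (v \<bullet> b) * \<omega> p b)" by (rule linear_basis_expansion[OF lin])
    also have "\<dots> = W p p v"
      unfolding W_def by (intro sum.cong refl) (simp add: M_def c)
    finally show "\<omega> p v = polar_form.form W p v" by (simp add: polar_form.form_def[OF W])
  qed
  ultimately show thesis using that by blast
qed

section \<open>Consequences of integrability\<close>

text \<open>
  Compares the coefficients of \<open>t\<close> in a polynomial of degree three by evaluating at \<open>0, 1, -1, 2\<close>.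
  This computes the derivative of \<open>\<omega> \<and> d\<omega>\<close> along a line.
\<close>

lemma cubic_linear_coeff:
  fixes a0 a1 a2 a3 b0 b1 b2 b3 c0 c1 c2 c3 d0 d1 d2 d3 :: real
  assumes "\<And>t. (a0 + t * a1 + t\<^sup>2 * a2) * (b0 + t * b1)
             + (c0 + t * c1 + t\<^sup>2 * c2) * (d0 + t * d1)
             + (a3 + t * b3 + t\<^sup>2 * b2) * (d2 + t * d3) = 0"
  shows "a0 * b1 + a1 * b0 + c0 * d1 + c1 * d0 + a3 * d3 + b3 * d2 = 0"
  using assms[of 0] assms[of 1] assms[of "-1"] assms[of 2] by (simp add: algebra_simps)

locale integrable_polar_form = polar_form +
  assumes integrable: "integrable_form1 form"
begin

lemma form_wedge_dform:
  "W p p u * dform p v w + W p p v * dform p w u + W p p w * dform p u v = 0"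
  using integrable by (simp add: integrable_form1_def wedge12_def d1_form) (simp add: form_def)

lemma derivative_form_wedge_dform:
  "2 * W p z u * dform p v w + W p p u * dform z v w
   + 2 * W p z v * dform p w u + W p p v * dform z w u
   + 2 * W p z w * dform p u v + W p p w * dform z u v = 0"
proof -
  have W: "W (p + t *\<^sub>R z) (p + t *\<^sub>R z) x = W p p x + t * (2 * W p z x) + t\<^sup>2 * W z z x" for t x
    by (simp add: W_linear W_sym[of z p] power2_eq_square algebra_simps)
  have D: "dform (p + t *\<^sub>R z) x y = dform p x y + t * dform z x y" for t x y
    by (simp add: linear_add[OF linear_dform(1)] linear_scale[OF linear_dform(1)])
  have "\<And>t. (W p p u + t * (2 * W p z u) + t\<^sup>2 * W z z u) * (dform p v w + t * dform z v w)
      + (W p p v + t * (2 * W p z v) + t\<^sup>2 * W z z v) * (dform p w u + t * dform z w u)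
      + (W p p w + t * (2 * W p z w) + t\<^sup>2 * W z z w) * (dform p u v + t * dform z u v) = 0"
    using form_wedge_dform[of "p + t *\<^sub>R z" u v w for t] by (simp only: W D)
  from cubic_linear_coeff[OF this] show ?thesis by simp
qed

text \<open>
  Antisymmetrizing the derivative of \<open>\<omega> \<and> d\<omega> = 0\<close> over its four arguments gives
  \<open>d\<omega> \<and> d\<omega> = 0\<close>; the terms with an undifferentiated \<open>\<omega>\<close> cancel because \<open>d d\<omega> = 0\<close>.
\<close>

lemma dform_wedge_dform:
  "dform p z u * dform p v w - dform p z v * dform p u w + dform p z w * dform p u v = 0"
proof -
  define E where "E z u v w = 2 * W p z u * dform p v w + W p p u * dform z v w
   + 2 * W p z v * dform p w u + W p p v * dform z w u
   + 2 * W p z w * dform p u v + W p p w * dform z u v" for z u v w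
  have "2 * (dform p z u * dform p v w - dform p z v * dform p u w + dform p z w * dform p u v)
      = E z u v w - E u z v w + E v z u w - E w z u v"
    by (simp add: E_def dform_def W_sym[of u z] W_sym[of v z] W_sym[of w z] W_sym[of v u] W_sym[of w u] W_sym[of w v]
        algebra_simps)
  then show ?thesis by (simp add: E_def derivative_form_wedge_dform)
qed

lemma dform_wedge_dform_polarized:
  "dform p u v * dform q w z - dform p u w * dform q v z + dform p u z * dform q v w
   + dform q u v * dform p w z - dform q u w * dform p v z + dform q u z * dform p v w = 0"
  using dform_wedge_dform[of "p + q" u v w z] dform_wedge_dform[of p u v w z] dform_wedge_dform[of q u v w z]
  by (simp add: linear_add[OF linear_dform(1)] algebra_simps)

text \<open>
  Contracting \<open>\<omega> \<and> d\<omega> = 0\<close> with \<open>v\<close> leaves \<open>\<omega>(v) d\<omega> = 0\<close>, and \<open>d\<omega>\<close> is nonzero off a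
  hyperplane. The vanishing in the other slots expresses invariance under translation along \<open>v\<close>.
\<close>

lemma radical_imp_form_eq_0:
  assumes rad: "\<And>p w. dform p v w = 0" and "dform p0 x y \<noteq> 0"
  shows "W p q v = 0" "W p v q = 0" "W v p q = 0"
proof -
  have "continuous_on UNIV (\<lambda>p. W p p v)"
    using smooth_W[of v] unfolding smooth_def by (metis Ck.simps(1))
  moreover have "W r r v * dform r x y = 0" for r
    using form_wedge_dform[of r v x y] rad[of r x] rad[of r y] dform_skew[of r y v] by simp
  ultimately have "W p p v = 0" for p
    using continuous_zero_of_zero_off_hyperplane[of "\<lambda>p. W p p v" "\<lambda>p. dform p x y" p0 p]
      linear_dform(1) assms(2) by blast
  then show *: "W p q v = 0" for p q
    using form_eq_0_imp_W_eq_0[of v p q] by (simp add: form_def)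
  show "W p v q = 0" using rad[of p q] *[of p q] by (simp add: dform_def)
  then show "W v p q = 0" by (simp add: W_sym[of v p])
qed

lemma form_modulo_radical:
  assumes rad: "\<And>p v w. dform p (v - R v) w = 0" and "dform p0 x y \<noteq> 0"
  shows "form p v = form (R p) (R v)"
proof -
  have 1: "W p q v = W p q (R v)" and 2: "W p v q = W p (R v) q" and 3: "W v p q = W (R v) p q" for p q v
    using radical_imp_form_eq_0[of "v - R v", OF rad assms(2)] by (simp_all add: W_linear)
  show ?thesis unfolding form_def by (metis 1 2 3)
qed

text \<open>
  \<open>S\<close> is a section of \<open>L\<close> modulo the radical of \<open>d\<omega>\<close>, so \<open>\<omega>\<close> is recovered from its
  restriction along \<open>S\<close>. A restriction of an integrable form is integrable.
\<close>

lemma linear_pullback_of_radical_complement: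
  fixes L :: "'a \<Rightarrow> 'b::euclidean_space"
  assumes L: "linear L" and S: "linear S" and rad: "\<And>p v w. dform p (v - S (L v)) w = 0"
    and nz: "dform p0 x y \<noteq> 0"
  shows "\<exists>\<eta>. smooth_form1 \<eta> \<and> integrable_form1 \<eta> \<and> form = pullback L \<eta>"
proof -
  define W' where "W' P Q V = W (S P) (S Q) (S V)" for P Q V
  interpret P: polar_form W'
    unfolding W'_def[abs_def] by (rule polar_form_linear_pullback[OF S])
  have d: "P.dform P U V = dform (S P) (S U) (S V)" and f: "P.form P V = form (S P) (S V)" for P U V
    by (simp_all add: P.dform_def dform_def P.form_def form_def W'_def)
  have "integrable_form1 P.form"
    using integrable unfolding integrable_form1_def wedge12_def P.d1_form d1_form d f by blast
  moreover have "form = pullback L P.form"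
  proof (intro ext)
    fix p v
    have "frechet_derivative L (at p) = L"
      using linear_imp_has_derivative[OF L] by (metis frechet_derivative_at)
    then show "form p v = pullback L P.form p v"
      using form_modulo_radical[of "\<lambda>v. S (L v)", OF rad nz, of p v] by (simp add: pullback_def f)
  qed
  ultimately show ?thesis using P.smooth_form1_form by blast
qed

end

section \<open>Exterior derivatives with a common factor\<close>

text \<open>
  Evaluates the plane normal form on vectors, so that it can be compared with \<open>W p p v\<close>: the
  components \<open>u\<close> and \<open>q = b p p / 2\<close> of the map have the differentials \<open>u\<close> and \<open>b p\<close>.
\<close>

lemma plane_pullback_formula:
  fixes u :: "'a::euclidean_space \<Rightarrow> real" and b :: "'a \<Rightarrow> 'a \<Rightarrow> real" and \<beta> \<theta> \<gamma> :: real
  defines "F \<equiv> \<lambda>p. vector [u p, b p p / 2] :: real^2"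
    and "\<eta> \<equiv> \<lambda>(P :: real^2) (V :: real^2). (\<gamma> * (P $ 1)\<^sup>2 + \<theta> * P $ 2) * V $ 1 + \<beta> * P $ 1 * V $ 2"
  assumes u: "linear u" and b: "bilinear b" and b_sym: "\<And>p q. b p q = b q p"
  shows "smooth F" "smooth_form1 \<eta>"
    "pullback F \<eta> p v = (\<gamma> * (u p)\<^sup>2 + \<theta> * (b p p / 2)) * u v + \<beta> * u p * b p v"
proof -
  have bb: "bounded_bilinear b" using b by (simp add: bilinear_conv_bounded_bilinear)
  have F: "F = (\<lambda>p. u p *\<^sub>R axis 1 1 + b p p *\<^sub>R axis 2 (1/2))"
    by (simp add: F_def fun_eq_iff vec_eq_iff forall_2 axis_def)
  have id: "smooth (\<lambda>p::'a. p)" by (rule smooth_linear) (simp add: linear_iff)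
  show "smooth F"
    unfolding F
    by (rule smooth_add[OF smooth_scaleR[OF smooth_linear[OF u] smooth_const]
          smooth_scaleR[OF smooth_bilinear[OF bb id id] smooth_const]])
  have coord: "smooth (\<lambda>P::real^2. P $ i)" for i
    by (rule smooth_linear) (simp add: linear_iff)
  have "smooth (\<lambda>P. \<eta> P V)" for V
    unfolding \<eta>_def power2_eq_square
    by (rule smooth_add[OF smooth_mult[OF smooth_add[OF smooth_mult[OF smooth_const smooth_mult[OF coord coord]]
            smooth_mult[OF smooth_const coord]] smooth_const]
          smooth_mult[OF smooth_mult[OF smooth_const coord] smooth_const]])
  moreover have "linear (\<eta> P)" for P
    by (intro linearI) (simp_all add: \<eta>_def algebra_simps)
  ultimately show "smooth_form1 \<eta>" by (simp add: smooth_form1_def)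
  have "(F has_derivative (\<lambda>v. u v *\<^sub>R axis 1 1 + (b p v + b v p) *\<^sub>R axis 2 (1/2))) (at p)"
    unfolding F
    by (intro has_derivative_add bounded_linear.has_derivative[OF bounded_linear_scaleR_left]
        linear_imp_has_derivative[OF u]
        bounded_bilinear.FDERIV[OF bb has_derivative_ident has_derivative_ident])
  then have "frechet_derivative F (at p) = (\<lambda>v. u v *\<^sub>R axis 1 1 + (b p v + b v p) *\<^sub>R axis 2 (1/2))"
    by (rule frechet_derivative_at[symmetric])
  then show "pullback F \<eta> p v = (\<gamma> * (u p)\<^sup>2 + \<theta> * (b p p / 2)) * u v + \<beta> * u p * b p v"
    using b_sym[of v p] by (simp add: pullback_def \<eta>_def F axis_def)
qed

context integrable_polar_form
begin

lemma closed_imp_plane_pullback: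
  assumes "\<And>p v w. dform p v w = 0"
  shows "\<exists>(F :: 'a \<Rightarrow> real^2) \<eta>. smooth F \<and> smooth_form1 \<eta> \<and> form = pullback F \<eta>"
proof -
  define f where "f p = W p p p / 3" for p
  define F where "F p = f p *\<^sub>R (axis 1 1 :: real^2)" for p
  define \<eta> where "\<eta> P V = V $ 1" for P V :: "real^2"
  have form: "form = d0 f" and f: "smooth f"
    unfolding f_def[abs_def] by (rule closed_imp_gradient[OF assms])+
  have "smooth F"
    unfolding F_def[abs_def] by (rule smooth_scaleR[OF f smooth_const])
  moreover have "smooth_form1 \<eta>"
    unfolding smooth_form1_def \<eta>_def[abs_def] by (simp add: smooth_const linear_iff)
  moreover have "form = pullback F \<eta>"
  proof (intro ext)
    fix p v
    have "(f has_derivative frechet_derivative f (at p)) (at p)"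
      by (rule iffD1[OF frechet_derivative_works smooth_differentiable[OF f]])
    then have "(F has_derivative (\<lambda>v. frechet_derivative f (at p) v *\<^sub>R axis 1 1)) (at p)"
      unfolding F_def[abs_def] by (rule bounded_linear.has_derivative[OF bounded_linear_scaleR_left])
    then have "frechet_derivative F (at p) = (\<lambda>v. frechet_derivative f (at p) v *\<^sub>R axis 1 1)"
      by (rule frechet_derivative_at[symmetric])
    then show "form p v = pullback F \<eta> p v"
      by (simp add: form pullback_def \<eta>_def d0_def)
  qed
  ultimately show ?thesis by blast
qed

text \<open>
  The case of rank at least two modulo \<open>u\<close>; \<open>rank\<close> is a nonzero minor of \<open>b\<close> on \<open>ker u\<close>.

  Subtracting the polar form of \<open>u dq\<close> from \<open>W\<close> leaves a trilinear form \<open>T\<close> that is symmetric in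
  all arguments, since \<open>\<omega> - u dq\<close> is closed. Integrability makes the quadratic map
  \<open>p \<mapsto> T p p\<close> parallel, on \<open>ker u\<close>, to the linear map \<open>p \<mapsto> b p\<close>. As the latter has rank at
  least two, the factor of proportionality is polynomial: \<open>T p p h = l p * b p h\<close> with \<open>l\<close>
  linear. Symmetry of \<open>T\<close> makes \<open>l\<close> a multiple of \<open>u\<close>, after which \<open>T\<close> is determined by its
  values on a vector \<open>t\<close> with \<open>u t = 1\<close>.
\<close>

lemma form_of_common_factor:
  fixes u :: "'a \<Rightarrow> real" and b :: "'a \<Rightarrow> 'a \<Rightarrow> real"
  assumes u: "linear u" "u t = 1" and b: "bilinear b" and bsym: "\<And>p q. b p q = b q p"
    and factor: "\<And>p v w. dform p v w = u v * b p w - u w * b p v"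
    and h12: "u h1 = 0" "u h2 = 0" and rank: "b p1 h1 * b p2 h2 - b p1 h2 * b p2 h1 \<noteq> 0"
  shows "\<exists>\<beta> \<theta> \<gamma>. \<forall>p v. form p v = (\<gamma> * (u p)\<^sup>2 + \<theta> * (b p p / 2)) * u v + \<beta> * u p * b p v"
proof -
  have b1: "linear (\<lambda>p. b p q)" and b2: "linear (b p)" for p q
    using b by (simp_all add: bilinear_def)
  note lin = linear_add[OF u(1)] linear_diff[OF u(1)] linear_scale[OF u(1)]
    linear_add[OF b1] linear_diff[OF b1] linear_scale[OF b1]
    linear_add[OF b2] linear_diff[OF b2] linear_scale[OF b2]
  have cont_b: "continuous_on UNIV (\<lambda>p. b p q)" for q
    using b1 by (simp add: linear_continuous_on linear_conv_bounded_linear)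
  have cont_u: "continuous_on UNIV u"
    using u(1) by (simp add: linear_continuous_on linear_conv_bounded_linear)
  have cont_W: "continuous_on UNIV (\<lambda>p. W p p v)" for v
    using smooth_W[of v] unfolding smooth_def by (metis Ck.simps(1))
  define T where "T p q v = W p q v - (u p * b q v + u q * b p v) / 2" for p q v
  have T12: "T p q v = T q p v" for p q v by (simp add: T_def W_sym[of p q])
  have T23: "T p q v = T p v q" for p q v
    using factor[of p q v] bsym[of q v] bsym[of p q] bsym[of p v]
    by (simp add: T_def dform_def field_simps)
  have T1: "T (p + p') q v = T p q v + T p' q v" "T (p - p') q v = T p q v - T p' q v"
    "T (r *\<^sub>R p) q v = r * T p q v" for p p' q v r
    by (simp_all add: T_def W_linear lin field_simps)
  have T2: "T q (p + p') v = T q p v + T q p' v" "T q (p - p') v = T q p v - T q p' v"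
    "T q (r *\<^sub>R p) v = r * T q p v" for p p' q v r
    by (simp_all add: T_def W_linear lin field_simps)
  have T3: "T q v (p + p') = T q v p + T q v p'" "T q v (p - p') = T q v p - T q v p'"
    "T q v (r *\<^sub>R p) = r * T q v p" for p p' q v r
    by (simp_all add: T_def W_linear lin field_simps)
  have diag: "T p p v = W p p v - u p * b p v" for p v by (simp add: T_def)
  have cont_T: "continuous_on UNIV (\<lambda>p. T p p v)" for v
    unfolding diag by (intro continuous_intros cont_W cont_b cont_u)
  have parallel: "T p p h * b p h' = T p p h' * b p h" if "u h = 0" "u h' = 0" for p h h'
    using form_wedge_dform[of p h h' t] that u(2) by (simp add: factor diag algebra_simps)

  \<comment> \<open>Divisibility: \<open>T p p h1 * b p h2 = T p p h2 * b p h1\<close>, and the linear functions \<open>b _ h1\<close> and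
    \<open>b _ h2\<close> are independent, so \<open>b _ h1\<close> divides \<open>T p p h1\<close>. The vector \<open>m\<close> leaves the kernel of
    the second one while staying in the kernel of the first.\<close>
  have zero: "T k k h1 = 0" if "b k h1 = 0" for k
  proof -
    define m where "m = b p1 h1 *\<^sub>R p2 - b p2 h1 *\<^sub>R p1"
    have m: "b m h1 = 0" "b m h2 \<noteq> 0" using rank by (simp_all add: m_def lin algebra_simps)
    have "T (k + s *\<^sub>R m) (k + s *\<^sub>R m) h1 * b (k + s *\<^sub>R m) h2 = 0" for s
      using parallel[OF h12, of "k + s *\<^sub>R m"] m(1) that by (simp add: lin)
    from continuous_zero_of_zero_off_hyperplane[OF cont_T b1 m(2) this] show ?thesis .
  qed
  have "b p1 h1 \<noteq> 0 \<or> b p2 h1 \<noteq> 0" using rank by auto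
  then obtain m' where "b m' h1 \<noteq> 0" by blast
  define m where "m = m' /\<^sub>R b m' h1"
  have m: "b m h1 = 1" using \<open>b m' h1 \<noteq> 0\<close> by (simp add: m_def lin)
  \<comment> \<open>the quotient, read off from the decomposition \<open>p = b p h1 *\<^sub>R m + k\<close> with \<open>T k k h1 = 0\<close>\<close>
  define l where "l p = b p h1 * T m m h1 + 2 * T m (p - b p h1 *\<^sub>R m) h1" for p
  have l: "linear l"
    by (intro linearI) (simp_all add: l_def lin T2 algebra_simps)
  have Th1: "T p p h1 = b p h1 * l p" for p
  proof -
    define k where "k = p - b p h1 *\<^sub>R m"
    have "b k h1 = 0" by (simp add: k_def lin m)
    then have "T k k h1 = 0" by (rule zero)
    moreover have "p = b p h1 *\<^sub>R m + k" by (simp add: k_def)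
    then have "T p p h1 = T (b p h1 *\<^sub>R m + k) (b p h1 *\<^sub>R m + k) h1" by simp
    ultimately show ?thesis
      by (simp add: T1 T2 T12[of k m] l_def k_def[symmetric] algebra_simps)
  qed
  have Th: "T p p h = l p * b p h" if "u h = 0" for p h
  proof -
    have "(T r r h - l r * b r h) * b r h1 = 0" for r
      using parallel[OF that h12(1), of r] Th1[of r] by (simp add: algebra_simps)
    moreover have "continuous_on UNIV (\<lambda>r. T r r h - l r * b r h)"
      using l by (intro continuous_intros cont_T cont_b)
        (simp add: linear_continuous_on linear_conv_bounded_linear)
    ultimately have "T p p h - l p * b p h = 0"
      using continuous_zero_of_zero_off_hyperplane[of "\<lambda>r. T r r h - l r * b r h" "\<lambda>r. b r h1" m p]
        b1 m by simp
    then show ?thesis by simp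
  qed
  have Th2: "2 * T p q h = l p * b q h + l q * b p h" if "u h = 0" for p q h
    using Th[OF that, of "p + q"] Th[OF that, of p] Th[OF that, of q] T12[of p q h]
    by (simp add: T1 T2 lin linear_add[OF l] algebra_simps)
  \<comment> \<open>By the symmetry of \<open>T\<close> in \<open>h\<close> and \<open>k\<close>, a nonzero value \<open>l h\<close> would make all functions
    \<open>b _ k\<close> proportional to \<open>b _ h\<close>, against the rank condition.\<close>
  have l0: "l h = 0" if h: "u h = 0" for h
  proof (rule ccontr)
    assume nz: "l h \<noteq> 0"
    have "l h * b p k = l k * b p h" if "u k = 0" for p k
      using Th2[OF h, of p k] Th2[OF that, of p h] T23[of p h k] bsym[of h k] by simp
    then have e: "b p k = l k / l h * b p h" if "u k = 0" for p k
      using that nz by (simp add: field_simps)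
    show False using rank unfolding e[OF h12(1)] e[OF h12(2)] by simp
  qed
  define c where "c = l t"
  have lu: "l p = c * u p" for p
    using l0[of "p - u p *\<^sub>R t"] u(2) by (simp add: lin linear_diff[OF l] linear_scale[OF l] c_def)
  \<comment> \<open>\<open>T p p\<close> agrees with \<open>c\<close> times the differential of \<open>u q\<close> on \<open>ker u\<close>; the constant \<open>\<delta>\<close> is what
    remains of the difference at \<open>p = t\<close>, where that differential takes the value \<open>3 / 2 * b t t\<close>.\<close>
  define \<delta> where "\<delta> = T t t t - 3 / 2 * c * b t t"
  have Tt: "T p p t = c * (b p p / 2 + u p * b p t) + \<delta> * (u p)\<^sup>2" for p
  proof -
    define h where "h = p - u p *\<^sub>R t"
    have h: "u h = 0" using u(2) by (simp add: h_def lin)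
    have p: "p = u p *\<^sub>R t + h" by (simp add: h_def)
    have 1: "T t t h = c * b t h" using Th[OF h, of t] u(2) by (simp add: lu)
    have 2: "2 * T t h h = c * b h h" using Th2[OF h, of t h] u(2) h by (simp add: lu)
    have 3: "b h t = b t h" "T t h t = T t t h" "T h t t = T t t h" "T h h t = T t h h"
      using bsym[of h t] T12[of t h t] T23[of t t h] T23[of h t h] T12[of h t h] T23[of h h t]
        T12[of h t t]
      by simp_all
    have P: "T p p t = (u p)\<^sup>2 * T t t t + 2 * u p * T t t h + T t h h"
      by (subst (1 2) p) (simp add: T1 T2 3 power2_eq_square algebra_simps)
    have Q: "b p p = (u p)\<^sup>2 * b t t + 2 * u p * b t h + b h h"
      by (subst (1 2) p) (simp add: lin 3 power2_eq_square algebra_simps)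
    have R: "b p t = u p * b t t + b t h"
      by (subst p) (simp add: lin 3)
    show ?thesis
      unfolding P Q R \<delta>_def using 1 2 by (simp add: power2_eq_square field_simps)
  qed
  have "form p v = (\<delta> * (u p)\<^sup>2 + c * (b p p / 2)) * u v + (1 + c) * u p * b p v" for p v
  proof -
    define h where "h = v - u v *\<^sub>R t"
    have h: "u h = 0" using u(2) by (simp add: h_def lin)
    have v: "v = u v *\<^sub>R t + h" by (simp add: h_def)
    have 1: "T p p v = u v * T p p t + T p p h"
      by (subst v) (simp add: T3)
    have 2: "b p v = u v * b p t + b p h"
      by (subst v) (simp add: lin)
    have "form p v = T p p v + u p * b p v" by (simp add: diag form_def)
    then show ?thesis
      unfolding 1 2 Th[OF h] Tt lu by (simp add: algebra_simps)
  qed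
  then show ?thesis by blast
qed

text \<open>
  Without a rank condition. In rank one, let \<open>b p1 h1\<close> be a nonzero entry on \<open>ker u\<close>: then \<open>u\<close> and
  the function \<open>g\<close>, proportional to \<open>b p1\<close> on \<open>ker u\<close>, cut out the radical of \<open>d\<omega>\<close>, and
  \<open>\<omega>\<close> is a pull-back along the linear map with these components.
\<close>

lemma plane_pullback_of_common_factor:
  fixes u :: "'a \<Rightarrow> real" and b :: "'a \<Rightarrow> 'a \<Rightarrow> real"
  assumes u: "linear u" and b: "bilinear b" and bsym: "\<And>p q. b p q = b q p"
    and factor: "\<And>p v w. dform p v w = u v * b p w - u w * b p v"
  shows "\<exists>(F :: 'a \<Rightarrow> real^2) \<eta>. smooth F \<and> smooth_form1 \<eta> \<and> form = pullback F \<eta>"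
proof (cases "\<forall>p v w. dform p v w = 0")
  case True
  then show ?thesis by (intro closed_imp_plane_pullback) simp
next
  case False
  then obtain p0 x y where nz: "dform p0 x y \<noteq> 0" by blast
  have b1: "linear (\<lambda>p. b p q)" and b2: "linear (b p)" for p q
    using b by (simp_all add: bilinear_def)
  note lin = linear_add[OF u] linear_diff[OF u] linear_scale[OF u]
    linear_add[OF b1] linear_diff[OF b1] linear_scale[OF b1]
    linear_add[OF b2] linear_diff[OF b2] linear_scale[OF b2]
  have "u x \<noteq> 0 \<or> u y \<noteq> 0" using nz factor by fastforce
  then obtain t' where "u t' \<noteq> 0" by blast
  define t where "t = t' /\<^sub>R u t'"
  have t: "u t = 1" using \<open>u t' \<noteq> 0\<close> by (simp add: t_def lin)
  show ?thesis
  proof (cases "\<exists>h1 h2 p1 p2. u h1 = 0 \<and> u h2 = 0 \<and> b p1 h1 * b p2 h2 - b p1 h2 * b p2 h1 \<noteq> 0")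
    case True
    then obtain h1 h2 p1 p2 where "u h1 = 0 \<and> u h2 = 0 \<and> b p1 h1 * b p2 h2 - b p1 h2 * b p2 h1 \<noteq> 0"
      by (elim exE)
    then have "u h1 = 0" "u h2 = 0" "b p1 h1 * b p2 h2 - b p1 h2 * b p2 h1 \<noteq> 0" by simp_all
    from form_of_common_factor[OF u t b bsym factor this] obtain \<beta> \<theta> \<gamma> where
      "\<And>p v. form p v = (\<gamma> * (u p)\<^sup>2 + \<theta> * (b p p / 2)) * u v + \<beta> * u p * b p v"
      by blast
    then have "form = pullback (\<lambda>p. vector [u p, b p p / 2] :: real^2)
        (\<lambda>P V. (\<gamma> * (P $ 1)\<^sup>2 + \<theta> * P $ 2) * V $ 1 + \<beta> * P $ 1 * V $ 2)"
      by (intro ext) (simp only: plane_pullback_formula(3)[OF u b bsym])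
    note * = conjI[OF plane_pullback_formula(1)[OF u b bsym]
        conjI[OF plane_pullback_formula(2)[OF u b bsym] this]]
    show ?thesis by (rule exI, rule exI, rule *)
  next
    case False
    have rank: "b p h * b q k = b p k * b q h" if "u h = 0" "u k = 0" for h k p q
    proof -
      have "\<not> b p h * b q k - b p k * b q h \<noteq> 0" using False that by blast
      then show ?thesis by simp
    qed
    have "\<exists>p h. u h = 0 \<and> b p h \<noteq> 0"
    proof (rule ccontr)
      assume *: "\<not> ?thesis"
      have e: "b p w = u w * b p t" for p w
      proof -
        have "u (w - u w *\<^sub>R t) = 0" using t by (simp add: lin)
        then have "b p (w - u w *\<^sub>R t) = 0" using * by blast
        then show ?thesis by (simp add: lin)
      qed
      have "dform p0 x y = 0" unfolding factor e[of p0 x] e[of p0 y] by simp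
      with nz show False by simp
    qed
    then obtain p1 h1 where h1: "u h1 = 0" "b p1 h1 \<noteq> 0" by blast
    define g where "g v = b p1 (v - u v *\<^sub>R t) / b p1 h1" for v
    define L where "L v = u v *\<^sub>R axis 1 1 + g v *\<^sub>R (axis 2 1 :: real^2)" for v
    define S where "S P = P $ 1 *\<^sub>R t + P $ 2 *\<^sub>R h1" for P :: "real^2"
    have "linear g"
      by (intro linearI) (simp_all add: g_def lin algebra_simps add_divide_distrib diff_divide_distrib)
    then have L: "linear L"
      by (intro linearI) (simp_all add: L_def lin linear_add linear_scale algebra_simps)
    have S: "linear S"
      by (intro linearI) (simp_all add: S_def algebra_simps)
    have "dform p (v - S (L v)) w = 0" for p v w
    proof -
      define k where "k = v - S (L v)"
      have k: "k = v - u v *\<^sub>R t - g v *\<^sub>R h1" by (simp add: k_def S_def L_def axis_def)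
      have uk: "u k = 0" using t h1 by (simp add: k lin)
      have "b p1 k = 0" using h1 unfolding k g_def by (simp add: lin)
      then have "b p k = 0" using rank[OF h1(1) uk, of p1 p] h1(2) by simp
      with uk show ?thesis unfolding k_def[symmetric] factor by simp
    qed
    from linear_pullback_of_radical_complement[OF L S this nz] smooth_linear[OF L]
    show ?thesis by blast
  qed
qed

end

section \<open>Pull-back from three-space\<close>

context integrable_polar_form
begin

text \<open>
  In the case of a common factor, \<open>b0 p w = d\<omega>\<^sub>p(t, w)\<close> satisfies \<open>d\<omega> = u \<and> b0\<close> but need not be
  symmetric. Adding a multiple of \<open>u\<close> to \<open>b0 p\<close> does not affect the product, and by
  closedness the multiple \<open>d\<omega>\<^sub>t(t, p)\<close> restores symmetry.
\<close>

lemma space_pullback: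
  "\<exists>(F :: 'a \<Rightarrow> real^3) \<eta>. smooth F \<and> smooth_form1 \<eta> \<and> integrable_form1 \<eta> \<and> form = pullback F \<eta>"
proof (cases "\<exists>(F :: 'a \<Rightarrow> real^2) \<eta>. smooth F \<and> smooth_form1 \<eta> \<and> form = pullback F \<eta>")
  case True
  then obtain F :: "'a \<Rightarrow> real^2" and \<eta> where "smooth F" "smooth_form1 \<eta>" and form: "form = pullback F \<eta>"
    by blast
  from plane_pullback_imp_space_pullback[OF this(1,2)] show ?thesis unfolding form .
next
  case False
  show ?thesis
  proof (cases rule: decomposable_family_cases[of dform, OF linear_dform(2) dform_skew
      dform_wedge_dform_polarized, case_names common_factor three_variables])
    case (common_factor u t)
    define b where "b p w = dform p t w + u w * dform t t p" for p w
    note lin = linear_add[OF linear_dform(1)] linear_scale[OF linear_dform(1)]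
      linear_add[OF linear_dform(2)] linear_scale[OF linear_dform(2)]
      linear_add[OF common_factor(1)] linear_scale[OF common_factor(1)]
    have "bilinear b"
      unfolding bilinear_def by (intro conjI allI linearI) (simp_all add: b_def lin algebra_simps)
    moreover have "b p w = b w p" for p w
      using dform_closed[of t p w] common_factor(3)[of t p w] dform_skew[of p w t]
      by (simp add: b_def)
    moreover have "dform p v w = u v * b p w - u w * b p v" for p v w
      using common_factor(3)[of p v w] by (simp add: b_def algebra_simps)
    ultimately show ?thesis
      using plane_pullback_of_common_factor[OF common_factor(1), of b] False by blast
  next
    case (three_variables l1 l2 l3 s1 s2 s3)
    define L where "L v = l1 v *\<^sub>R axis 1 1 + l2 v *\<^sub>R axis 2 1 + l3 v *\<^sub>R (axis 3 1 :: real^3)" for v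
    define S where "S P = P $ 1 *\<^sub>R s1 + P $ 2 *\<^sub>R s2 + P $ 3 *\<^sub>R s3" for P :: "real^3"
    have L: "linear L"
      using three_variables(1-3)
      by (intro linearI) (simp_all add: L_def linear_add linear_scale algebra_simps)
    have S: "linear S"
      by (intro linearI) (simp_all add: S_def algebra_simps)
    have "S (L v) = l1 v *\<^sub>R s1 + l2 v *\<^sub>R s2 + l3 v *\<^sub>R s3" for v
      by (simp add: S_def L_def axis_def)
    then have rad: "dform p (v - S (L v)) w = 0" for p v w
      using three_variables(4)[of p v w] by simp
    obtain p0 x y where "dform p0 x y \<noteq> 0" using closed_imp_plane_pullback False by blast
    from linear_pullback_of_radical_complement[OF L S rad this] smooth_linear[OF L]
    show ?thesis by blast
  qed
qed

end

section \<open>Linear coordinates and the normal form of the quadratic function\<close>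

lemma linear_coordinates_expansion:
  fixes e :: "nat \<Rightarrow> 'a::euclidean_space"
  assumes "linear_coordinates e x"
  shows "v = (\<Sum>i<DIM('a). x i v *\<^sub>R e i)"
proof -
  let ?n = "DIM('a)"
  have lin: "linear (x i)" if "i < ?n" for i using assms that by (simp add: linear_coordinates_def)
  have dual: "x i (e j) = (if i = j then 1 else 0)" if "i < ?n" "j < ?n" for i j
    using assms that by (simp add: linear_coordinates_def)
  have inj: "inj_on e {..<?n}"
    by (intro inj_onI) (metis dual lessThan_iff zero_neq_one)
  have "independent (e ` {..<?n})"
  proof
    assume "dependent (e ` {..<?n})"
    then obtain c j where z: "(\<Sum>v\<in>e ` {..<?n}. c v *\<^sub>R v) = 0" and j: "j < ?n" and nz: "c (e j) \<noteq> 0"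
      by (auto simp: dependent_finite)
    have "0 = x j (\<Sum>i<?n. c (e i) *\<^sub>R e i)"
      using z linear_0[OF lin[OF j]] by (simp add: sum.reindex[OF inj])
    also have "\<dots> = (\<Sum>i<?n. c (e i) * (if j = i then 1 else 0))"
      by (simp add: linear_sum[OF lin[OF j]] linear_scale[OF lin[OF j]] dual j)
    also have "\<dots> = (\<Sum>i<?n. if i = j then c (e i) else 0)" by (intro sum.cong) auto
    also have "\<dots> = c (e j)" using j by simp
    finally show False using nz by simp
  qed
  moreover have "card (e ` {..<?n}) = ?n" using card_image[OF inj] by simp
  ultimately have span: "v \<in> span (e ` {..<?n})"
    using card_ge_dim_independent[of "e ` {..<?n}" UNIV] by auto
  have lin_sum: "linear (\<lambda>v. \<Sum>i<?n. x i v *\<^sub>R e i)"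
    by (intro linearI)
       (simp_all add: linear_add[OF lin] linear_scale[OF lin] sum.distrib scaleR_left_distrib scaleR_sum_right)
  have fixed: "(\<Sum>i<?n. x i (e j) *\<^sub>R e i) = e j" if "j < ?n" for j
  proof -
    have "(\<Sum>i<?n. x i (e j) *\<^sub>R e i) = (\<Sum>i<?n. if i = j then e i else 0)"
      using that by (intro sum.cong) (simp_all add: dual)
    then show ?thesis using that by simp
  qed
  show ?thesis
  proof (rule linear_eq_on_span[OF linear_ident lin_sum _ span])
    fix w assume "w \<in> e ` {..<?n}"
    then obtain j where w: "w = e j" and "j < ?n" by auto
    from fixed[OF this(2)] show "w = (\<Sum>i<?n. x i w *\<^sub>R e i)" unfolding w by (rule HOL.sym)
  qed
qed

lemma d0_linear: "linear f \<Longrightarrow> d0 f p = f"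
  unfolding d0_def by (metis frechet_derivative_at linear_imp_has_derivative)

lemma d0_quadratic:
  assumes "bilinear b" and "\<And>p q. b p q = b q p"
  shows "d0 (\<lambda>p. b p p / 2) p = b p"
proof -
  have "bounded_bilinear b" using assms(1) by (simp add: bilinear_conv_bounded_bilinear)
  from bounded_bilinear.FDERIV[OF this has_derivative_ident has_derivative_ident, of p UNIV]
  have "((\<lambda>p. (1/2) * b p p) has_derivative (\<lambda>h. (1/2) * (b p h + b h p))) (at p)"
    by (rule has_derivative_mult_right)
  moreover have "(\<lambda>h. (1/2) * (b p h + b h p)) = b p" using assms(2)[of p] by (simp add: fun_eq_iff)
  ultimately show ?thesis unfolding d0_def by (simp add: frechet_derivative_at[symmetric])
qed

text \<open>
  The symmetric bilinear form whose value on the diagonal is twice \<open>normal_q\<close>.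
\<close>

definition polar_q ::
    "nat \<Rightarrow> nat \<Rightarrow> (nat \<Rightarrow> real) \<Rightarrow> (nat \<Rightarrow> 'a \<Rightarrow> real) \<Rightarrow> 'a \<Rightarrow> 'a \<Rightarrow> real" where
  "polar_q r \<epsilon> \<sigma> x p q = (\<Sum>i=1..r. \<sigma> i * x i p * x i q)
     + x 0 p * (real \<epsilon> * x (r + 1) q) + x 0 q * (real \<epsilon> * x (r + 1) p)"

lemma normal_q_eq_polar_q: "normal_q r \<epsilon> \<sigma> x = (\<lambda>p. polar_q r \<epsilon> \<sigma> x p p / 2)"
  by (simp add: fun_eq_iff normal_q_def polar_q_def add_divide_distrib sum_divide_distrib
      power2_eq_square mult.assoc)

lemma polar_q_sym: "polar_q r \<epsilon> \<sigma> x p q = polar_q r \<epsilon> \<sigma> x q p"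
  by (simp add: polar_q_def mult.assoc mult.commute[of "x _ p" "x _ q"])

lemma bilinear_polar_q:
  fixes x :: "nat \<Rightarrow> 'a::euclidean_space \<Rightarrow> real"
  assumes "normal_coordinates r \<epsilon> \<sigma> e x"
  shows "bilinear (polar_q r \<epsilon> \<sigma> x)"
proof -
  have lin: "linear (x i)" if "i < DIM('a)" for i
    using assms that by (simp add: normal_coordinates_def linear_coordinates_def)
  have r: "1 + r + \<epsilon> \<le> DIM('a)" "\<epsilon> \<in> {0, 1}" using assms by (simp_all add: normal_coordinates_def)
  \<comment> \<open>If \<open>\<epsilon> = 0\<close> then \<open>x (r + 1)\<close> may lie outside the range of the coordinates and need not be
    linear, but the product with \<open>\<epsilon>\<close> is.\<close>
  define y where "y p = real \<epsilon> * x (r + 1) p" for p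
  have y: "linear y"
  proof (cases "\<epsilon> = 0")
    case True
    then show ?thesis by (simp add: y_def[abs_def] linear_iff)
  next
    case False
    then have "linear (x (r + 1))" using r lin by auto
    then show ?thesis using False r by (simp add: y_def[abs_def])
  qed
  have xi: "linear (x i)" if "i \<in> {1..r}" for i using that r lin by auto
  have x0: "linear (x 0)" using lin by simp
  have P: "polar_q r \<epsilon> \<sigma> x p q = (\<Sum>i=1..r. \<sigma> i * x i p * x i q) + x 0 p * y q + x 0 q * y p" for p q
    by (simp add: polar_q_def y_def)
  have "linear (polar_q r \<epsilon> \<sigma> x p)" for p
    unfolding P[abs_def]
    by (intro linear_compose_add linear_compose_sum ballI)
       (simp_all add: linear_iff linear_add[OF xi] linear_scale[OF xi] linear_add[OF x0]
         linear_scale[OF x0] linear_add[OF y] linear_scale[OF y] algebra_simps)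
  moreover from this have "linear (\<lambda>p. polar_q r \<epsilon> \<sigma> x p q)" for q
    by (subst polar_q_sym)
  ultimately show ?thesis by (simp add: bilinear_def)
qed

text \<open>
  The condition of \<open>form_of_common_factor\<close>, with the vectors \<open>e 1\<close> and \<open>e 2\<close> of \<open>ker (x 0)\<close>. Since
  \<open>\<epsilon> \<le> 1\<close>, there are two cases: \<open>x 2\<close> is the coordinate \<open>y\<^sub>2\<close>, or \<open>r = \<epsilon> = 1\<close> and \<open>x 2\<close> is
  \<open>z\<close>, whose partner in \<open>q\<close> is \<open>x 0\<close>.
\<close>

lemma polar_q_rank_2:
  fixes x :: "nat \<Rightarrow> 'a::euclidean_space \<Rightarrow> real"
  assumes nc: "normal_coordinates r \<epsilon> \<sigma> e x" and "2 \<le> r + \<epsilon>"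
  shows "x 0 (e 1) = 0" "x 0 (e 2) = 0"
    "\<exists>p1 p2. polar_q r \<epsilon> \<sigma> x p1 (e 1) * polar_q r \<epsilon> \<sigma> x p2 (e 2)
     - polar_q r \<epsilon> \<sigma> x p1 (e 2) * polar_q r \<epsilon> \<sigma> x p2 (e 1) \<noteq> 0"
proof -
  have dual: "x i (e j) = (if i = j then 1 else 0)" if "i < DIM('a)" "j < DIM('a)" for i j
    using nc that by (simp add: normal_coordinates_def linear_coordinates_def)
  have n: "1 + r + \<epsilon> \<le> DIM('a)" "\<epsilon> = 0 \<or> \<epsilon> = 1"
    using nc by (auto simp: normal_coordinates_def)
  have "\<sigma> i \<in> {-1, 1}" if "i \<in> {1..r}" for i
    using nc that unfolding normal_coordinates_def by blast
  then have \<sigma>: "\<sigma> i \<noteq> 0" if "i \<in> {1..r}" for i using that by fastforce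
  have r: "1 \<le> r" using n assms(2) by auto
  have z: "x 0 (e j) = 0" if "j = 1 \<or> j = 2" for j using that n assms(2) by (subst dual) auto
  have y: "real \<epsilon> * x (r + 1) (e j) = (if r + 1 = j then real \<epsilon> else 0)" if "j < DIM('a)" for j
    using n that by (auto simp: dual)
  have q: "polar_q r \<epsilon> \<sigma> x p (e j) = (if j \<le> r then \<sigma> j * x j p else 0) + x 0 p * (if r + 1 = j then real \<epsilon> else 0)"
    if "j = 1 \<or> j = 2" for p j
  proof -
    have "(\<Sum>i=1..r. \<sigma> i * x i p * x i (e j)) = (\<Sum>i=1..r. if i = j then \<sigma> i * x i p else 0)"
      using n assms(2) that by (intro sum.cong) (auto simp: dual)
    also have "\<dots> = (if j \<le> r then \<sigma> j * x j p else 0)" using that by auto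
    finally have s: "(\<Sum>i=1..r. \<sigma> i * x i p * x i (e j)) = (if j \<le> r then \<sigma> j * x j p else 0)" .
    have "j < DIM('a)" using that n assms(2) by auto
    from y[OF this] show ?thesis unfolding polar_q_def s z[OF that] by simp
  qed
  have q1: "polar_q r \<epsilon> \<sigma> x p (e 1) = \<sigma> 1 * x 1 p" for p
    using q[of 1 p] r by simp
  show "x 0 (e 1) = 0" "x 0 (e 2) = 0" by (rule z, simp)+
  show "\<exists>p1 p2. polar_q r \<epsilon> \<sigma> x p1 (e 1) * polar_q r \<epsilon> \<sigma> x p2 (e 2)
     - polar_q r \<epsilon> \<sigma> x p1 (e 2) * polar_q r \<epsilon> \<sigma> x p2 (e 1) \<noteq> 0"
  proof (cases "2 \<le> r")
    case True
    then have "polar_q r \<epsilon> \<sigma> x p (e 2) = \<sigma> 2 * x 2 p" for p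
      using q[of 2 p] by simp
    then show ?thesis
      using True n \<sigma>[of 1] \<sigma>[of 2] by (intro exI[of _ "e 1"] exI[of _ "e 2"]) (simp_all add: q1[unfolded One_nat_def] dual)
  next
    case False
    then have "r = 1" "\<epsilon> = 1" using r n assms(2) by auto
    then have "polar_q r \<epsilon> \<sigma> x p (e 2) = x 0 p" for p
      using q[of 2 p] by simp
    moreover have "x 1 (e 1) = 1" "x 1 (e 0) = 0" "x 0 (e 1) = 0" "x 0 (e 0) = 1"
      using n \<open>\<epsilon> = 1\<close> \<open>r = 1\<close> by (simp_all add: dual)
    ultimately have "polar_q r \<epsilon> \<sigma> x (e 1) (e 1) * polar_q r \<epsilon> \<sigma> x (e 0) (e 2)
      - polar_q r \<epsilon> \<sigma> x (e 1) (e 2) * polar_q r \<epsilon> \<sigma> x (e 0) (e 1) = \<sigma> 1"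
      by (simp only: q1)
    then show ?thesis
      using \<sigma>[of 1] r by (intro exI[of _ "e 1"] exI[of _ "e 0"]) simp
  qed
qed

section \<open>Quadratic integrable 1-forms\<close>

theorem theorem4p1:
  fixes \<omega> :: "(real ^ 'n) form1" and \<Omega> :: "(nat \<Rightarrow> real ^ 'n) \<Rightarrow> real"
  assumes "volume_form \<Omega>" and "quadratic_form1 \<omega>" and "integrable_form1 \<omega>"
  shows
    "(\<exists>(F :: real ^ 'n \<Rightarrow> real ^ 3) \<eta>.
        smooth F \<and> smooth_form1 \<eta> \<and> integrable_form1 \<eta> \<and> \<omega> = pullback F \<eta>)
     \<and>
     (type2 \<Omega> (d1 \<omega>) \<and> (CARD('n) = 3 \<or> d1 \<omega> \<noteq> (\<lambda>p u v. 0)) \<longrightarrow>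
        (\<exists>e x (a :: nat \<Rightarrow> real \<Rightarrow> real \<Rightarrow> real \<Rightarrow> real).
           linear_coordinates e x \<and>
           \<omega> = (\<lambda>p v. \<Sum>i<3. a i (x 0 p) (x 1 p) (x 2 p) * d0 (x i) p v)))
     \<and>
     (\<forall>r \<epsilon>. type1_with r \<epsilon> (d1 \<omega>) \<and> 2 \<le> r + \<epsilon> \<longrightarrow>
        (\<exists>\<sigma> e x. \<exists>\<beta> \<theta> \<gamma> :: real.
           normal_coordinates r \<epsilon> \<sigma> e x \<and>
           \<omega> = pullback (\<lambda>p. vector [x 0 p, normal_q r \<epsilon> \<sigma> x p] :: real ^ 2)
                 (\<lambda>P V. (\<gamma> * (P $ 1)\<^sup>2 + \<theta> * P $ 2) * V $ 1 + \<beta> * P $ 1 * V $ 2)))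
     \<and>
     (type1 (d1 \<omega>) \<longrightarrow>
        (\<exists>(F :: real ^ 'n \<Rightarrow> real ^ 2) \<eta>. smooth F \<and> smooth_form1 \<eta> \<and> \<omega> = pullback F \<eta>))"
proof -
  obtain W where "polar_form W" and \<omega>: "\<omega> = polar_form.form W"
    using quadratic_form1_polar[OF assms(2)] .
  then interpret integrable_polar_form W
    using assms(3) by (simp add: integrable_polar_form_def integrable_polar_form_axioms_def)
  have type1: "x 0 (e 0) = 1" "linear (x 0)"
      "dform p v w = x 0 v * polar_q r \<epsilon> \<sigma> x p w - x 0 w * polar_q r \<epsilon> \<sigma> x p v"
    if nc: "normal_coordinates r \<epsilon> \<sigma> e x" and d: "d1 \<omega> = wedge11 (d0 (x 0)) (d0 (normal_q r \<epsilon> \<sigma> x))"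
    for r \<epsilon> \<sigma> e p v w and x :: "nat \<Rightarrow> real^'n \<Rightarrow> real"
  proof -
    show "linear (x 0)" "x 0 (e 0) = 1"
      using nc by (simp_all add: normal_coordinates_def linear_coordinates_def)
    show "dform p v w = x 0 v * polar_q r \<epsilon> \<sigma> x p w - x 0 w * polar_q r \<epsilon> \<sigma> x p v"
      using d unfolding \<omega> d1_form normal_q_eq_polar_q
      by (simp add: wedge11_def d0_linear[OF \<open>linear (x 0)\<close>]
          d0_quadratic[OF bilinear_polar_q[OF nc] polar_q_sym])
  qed
  show ?thesis
  proof (intro conjI impI allI)
    show "\<exists>(F :: real ^ 'n \<Rightarrow> real ^ 3) \<eta>.
        smooth F \<and> smooth_form1 \<eta> \<and> integrable_form1 \<eta> \<and> \<omega> = pullback F \<eta>"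
      unfolding \<omega> by (rule space_pullback)
  next
    assume *: "type2 \<Omega> (d1 \<omega>) \<and> (CARD('n) = 3 \<or> d1 \<omega> \<noteq> (\<lambda>p u v. 0))"
    then obtain D e x X where n: "3 \<le> DIM(real^'n)" and D: "\<And>p u w. contraction (D p) \<Omega> u w = d1 \<omega> p u w"
      and lc: "linear_coordinates e x"
      and Dp: "\<And>p. D p = wedge_vectors (\<lambda>i. if i < DIM(real^'n) - 3 then e (i + 3) else X p)"
      unfolding type2_def by blast
    let ?n = "DIM(real^'n)"
    \<comment> \<open>The factor \<open>e k\<close> of \<open>D\<close> occurs twice in the volume form when \<open>i\<^sub>D \<Omega>\<close> is evaluated on it.\<close>
    have rad: "dform p (e k) w = 0" if k: "3 \<le> k" "k < ?n" for p k w
    proof -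
      define v where "v i = (if i < ?n - 2 then (if i < ?n - 3 then e (i + 3) else X p)
        else if i = ?n - 2 then e k else w)" for i
      have "dform p (e k) w = \<Omega> v"
        using D[of p "e k" w]
        unfolding \<omega> d1_form contraction_def Dp wedge_vectors_def v_def[abs_def] by (rule sym)
      moreover have "v (k - 3) = v (?n - 2)" "k - 3 < ?n - 2" "?n - 2 < ?n" using k n by (auto simp: v_def)
      moreover have "\<Omega> v = 0" if "i < j" "j < ?n" "v i = v j" for v i j
        using assms(1) that unfolding volume_form_def by (elim conjE) blast
      ultimately show ?thesis by metis
    qed
    define R where "R v = (\<Sum>i<3. x i v *\<^sub>R e i)" for v
    have R: "v - R v = (\<Sum>i\<in>{3..<?n}. x i v *\<^sub>R e i)" for v
    proof -
      have "v = (\<Sum>i<?n. x i v *\<^sub>R e i)" by (rule linear_coordinates_expansion[OF lc])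
      also have "\<dots> = R v + (\<Sum>i\<in>{3..<?n}. x i v *\<^sub>R e i)"
        using n unfolding R_def lessThan_atLeast0
        by (intro sum.atLeastLessThan_concat[symmetric]) auto
      finally show ?thesis by (simp add: algebra_simps)
    qed
    have form_R: "form p v = form (R p) (R v)" for p v
    proof (cases "CARD('n) = 3")
      case True
      then show ?thesis using R by simp
    next
      case False
      with * obtain p0 y z where nz: "dform p0 y z \<noteq> 0"
        unfolding \<omega> d1_form by blast
      have lin: "linear (\<lambda>v. dform p v w)" for p w
        using linear_compose_neg[OF linear_dform(2)[of p w]] by (subst dform_skew)
      have "dform p (v - R v) w = 0" for p v w
      proof -
        have "dform p (v - R v) w = (\<Sum>i\<in>{3..<?n}. x i v * dform p (e i) w)"
          unfolding R by (simp only: linear_sum[OF lin] linear_scale[OF lin] real_scaleR_def)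
        also have "\<dots> = 0"
        proof (intro sum.neutral ballI)
          fix i assume "i \<in> {3..<?n}"
          then have "dform p (e i) w = 0" by (intro rad) auto
          then show "x i v * dform p (e i) w = 0" by simp
        qed
        finally show ?thesis .
      qed
      then show ?thesis by (rule form_modulo_radical[of R, OF _ nz])
    qed
    define a where "a i y0 y1 y2 = form (y0 *\<^sub>R e 0 + y1 *\<^sub>R e 1 + y2 *\<^sub>R e 2) (e i)" for i y0 y1 y2
    have "\<omega> = (\<lambda>p v. \<Sum>i<3. a i (x 0 p) (x 1 p) (x 2 p) * d0 (x i) p v)"
    proof (intro ext)
      fix p v
      have lin: "linear (form q)" for q using linear_form by (simp add: form_def[abs_def])
      have x: "d0 (x i) p v = x i v" if "i < 3" for i
        using lc that n by (subst d0_linear) (auto simp: linear_coordinates_def)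
      have Rp: "R p = x 0 p *\<^sub>R e 0 + x 1 p *\<^sub>R e 1 + x 2 p *\<^sub>R e 2"
        by (simp add: R_def eval_nat_numeral)
      have "form p v = form (R p) (\<Sum>i<3. x i v *\<^sub>R e i)"
        using form_R by (simp only: R_def)
      also have "\<dots> = (\<Sum>i<3. a i (x 0 p) (x 1 p) (x 2 p) * x i v)"
        by (simp only: linear_sum[OF lin] linear_scale[OF lin] a_def Rp) (simp add: mult.commute)
      also have "\<dots> = (\<Sum>i<3. a i (x 0 p) (x 1 p) (x 2 p) * d0 (x i) p v)"
        by (intro sum.cong) (simp_all add: x)
      finally show "\<omega> p v = (\<Sum>i<3. a i (x 0 p) (x 1 p) (x 2 p) * d0 (x i) p v)"
        unfolding \<omega> .
    qed
    from conjI[OF lc this] show "\<exists>e x (a :: nat \<Rightarrow> real \<Rightarrow> real \<Rightarrow> real \<Rightarrow> real). linear_coordinates e x \<and>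
           \<omega> = (\<lambda>p v. \<Sum>i<3. a i (x 0 p) (x 1 p) (x 2 p) * d0 (x i) p v)"
      by (intro exI[of _ e] exI[of _ x] exI[of _ a])
  next
    fix r \<epsilon> assume *: "type1_with r \<epsilon> (d1 \<omega>) \<and> 2 \<le> r + \<epsilon>"
    then obtain \<sigma> e x where nc: "normal_coordinates r \<epsilon> \<sigma> e x"
      and "d1 \<omega> = wedge11 (d0 (x 0)) (d0 (normal_q r \<epsilon> \<sigma> x))"
      unfolding type1_with_def by blast
    note t = type1[OF this]
    note b = bilinear_polar_q[OF nc] polar_q_sym
    note h = polar_q_rank_2[OF nc conjunct2[OF *]]
    from h(3) obtain p1 p2 where rank: "polar_q r \<epsilon> \<sigma> x p1 (e 1) * polar_q r \<epsilon> \<sigma> x p2 (e 2)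
        - polar_q r \<epsilon> \<sigma> x p1 (e 2) * polar_q r \<epsilon> \<sigma> x p2 (e 1) \<noteq> 0"
      by (elim exE)
    have "\<exists>\<beta> \<theta> \<gamma>. \<forall>p v. form p v = (\<gamma> * (x 0 p)\<^sup>2 + \<theta> * (polar_q r \<epsilon> \<sigma> x p p / 2)) * x 0 v
        + \<beta> * x 0 p * polar_q r \<epsilon> \<sigma> x p v"
      by (rule form_of_common_factor[OF t(2,1) b t(3) h(1,2) rank])
    then obtain \<beta> \<theta> \<gamma> where f: "\<And>p v. form p v = (\<gamma> * (x 0 p)\<^sup>2 + \<theta> * (polar_q r \<epsilon> \<sigma> x p p / 2)) * x 0 v
        + \<beta> * x 0 p * polar_q r \<epsilon> \<sigma> x p v"
      by (elim exE) (rule that, drule spec, erule spec)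
    have "\<omega> = pullback (\<lambda>p. vector [x 0 p, normal_q r \<epsilon> \<sigma> x p] :: real ^ 2)
                 (\<lambda>P V. (\<gamma> * (P $ 1)\<^sup>2 + \<theta> * P $ 2) * V $ 1 + \<beta> * P $ 1 * V $ 2)"
      unfolding \<omega> normal_q_eq_polar_q
      by (intro ext) (simp only: f plane_pullback_formula(3)[OF t(2) b])
    from conjI[OF nc this] show "\<exists>\<sigma> e x. \<exists>\<beta> \<theta> \<gamma> :: real. normal_coordinates r \<epsilon> \<sigma> e x \<and>
           \<omega> = pullback (\<lambda>p. vector [x 0 p, normal_q r \<epsilon> \<sigma> x p] :: real ^ 2)
                 (\<lambda>P V. (\<gamma> * (P $ 1)\<^sup>2 + \<theta> * P $ 2) * V $ 1 + \<beta> * P $ 1 * V $ 2)"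
      by (intro exI[of _ \<sigma>] exI[of _ e] exI[of _ x] exI[of _ \<beta>] exI[of _ \<theta>] exI[of _ \<gamma>])
  next
    assume "type1 (d1 \<omega>)"
    then obtain r \<epsilon> \<sigma> e x where nc: "normal_coordinates r \<epsilon> \<sigma> e x"
      and "d1 \<omega> = wedge11 (d0 (x 0)) (d0 (normal_q r \<epsilon> \<sigma> x))"
      unfolding type1_def type1_with_def by blast
    note t = type1[OF this]
    show "\<exists>(F :: real ^ 'n \<Rightarrow> real ^ 2) \<eta>. smooth F \<and> smooth_form1 \<eta> \<and> \<omega> = pullback F \<eta>"
      unfolding \<omega>
      by (rule plane_pullback_of_common_factor[OF t(2) bilinear_polar_q[OF nc] polar_q_sym t(3)])
  qed
qed

end
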